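(* Let $n\in\mathbb{N}$ and let $\mathfrak{N}$ be the class of non-degenerate ReLU networks with integer weights and biases, with $n$ input nodes, realizing functions $f:[0,1]^n\to[0,1]$. For all $\mathcal{N}_1,\mathcal{N}_2\in\mathfrak{N}$: if $\langle\mathcal{N}_1\rangle(x)=\langle\mathcal{N}_2\rangle(x)$ for all $x\in[0,1]^n$, then $\mathcal{N}_1\overset{\mathcal{MV}}{\sim}\mathcal{N}_2$, i.e. the formula $[\mathrm{ext}(\mathcal{N}_2)]$ represented by the substitution graph extracted from $\mathcal{N}_2$ is derivable from the formula $[\mathrm{ext}(\mathcal{N}_1)]$ in finitely many steps by application of the MV axioms.
   Context: **Layered graphs and networks.** A layered graph of depth $L\ge1$ and architecture $(d_0,\dots,d_L)$, $d_L=1$, $d_j\ge 1$, has nodes partitioned into levels $V^{(j)}=\{v^{(j)}_1,\dots,v^{(j)}_{d_j}\}$, $j=0,\dots,L$, $V^{(L)}=\{v_{\rm out}\}$, with edges exactly all pairs (node of level $j-1$, node of level $j$), $j=1,\dots,L$. A neural network is a layered graph with a weight $w_{v,u}\in\mathbb{R}$ on each edge $(u,v)$ (possibly zero), a bias $b_v$ at each non-input node, and activation functions. $V^{(0)}$ are input nodes; nodes at levels $1,\dots,L-1$ are hidden. In a ReLU network ($\rho$-network) all hidden nodes have activation $\rho(t)=\max\{t,0\}$ and the output node has none; in a $\sigma$-network all non-input nodes (output included) have activation $\sigma(t)=\max\{\min\{t,1\},0\}$. The local map $\langle v\rangle$ of a node at level $j\ge 1$ is $x\mapsto\psi_v(\sum_{i'}w_{v,v^{(j-1)}_{i'}}x_{i'}+b_v)$,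 $x\in\mathbb{R}^{d_{j-1}}$ ($\psi_v$ the activation, or identity if none), and $\langle v_i^{(0)}\rangle(x)=x_i$. The global map $\langle\!\langle v\rangle\!\rangle:\mathbb{R}^{d_0}\to\mathbb{R}$ is obtained by composing local maps from the inputs on, and $\langle\mathcal{N}\rangle=\langle\!\langle v_{\rm out}\rangle\!\rangle$. "Realizing a function $[0,1]^n\to[0,1]$" means $d_0=n$ and $\langle\mathcal N\rangle([0,1]^n)\subseteq[0,1]$. **Non-degenerate.** A ReLU network is non-degenerate (on $[0,1]^{d_0}$) if: every hidden node $v$ satisfies $\langle\!\langle v\rangle\!\rangle(x)>0$ for some $x\in[0,1]^{d_0}$; every hidden node satisfies $\langle\!\langle v\rangle\!\rangle(x)=0$ for some $x\in[0,1]^{d_0}$; no two nodes at the same level have the same local map; every hidden node has at least one nonzero outgoing weight. **Formulae.** A Łukasiewicz formula is a finite string built from propositional variables $x_1,x_2,\dots$ and constants $0,1$ with binary connectives $\oplus,\odot$ and unary $\lnot$. Evaluating in $\mathbb{I}=([0,1],\oplus,\odot,\lnot,0,1)$, $x\oplus y=\min\{1,x+y\}$, $x\odot y=\max\{0,x+y-1\}$, $\lnot x=1-x$, gives the truth function $\tau^{\mathbb{I}}$. **MV axioms** ($\mathcal{MV}$): $x\oplus y=y\oplus x$; $x\odot y=y\odot x$; $x\oplus(y\oplus z)=(x\oplus y)\oplus z$; $x\odot(y\odot z)=(x\odot y)\odot z$; $x\oplus\lnot x=1$; $x\odot\lnot x=0$; $x\oplus1=1$; $x\odot0=0$; $x\oplus0=x$;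 $x\odot1=x$; $\lnot(x\oplus y)=\lnot x\odot\lnot y$; $\lnot(x\odot y)=\lnot x\oplus\lnot y$; $x=\lnot(\lnot x)$; $\lnot0=1$; $(x\odot\lnot y)\oplus y=(y\odot\lnot x)\oplus x$; $(x\oplus\lnot y)\odot y=(y\oplus\lnot x)\odot x$. **Derivation.** An equation $\gamma=\gamma'$ instantiates an axiom $\epsilon=\epsilon'$ if, for some substitution of formulae for variables applied to both sides, it becomes $\gamma=\gamma'$ or $\gamma'=\gamma$. A derivation step replaces one occurrence of a subformula $\gamma$ by $\gamma'$ where $\gamma=\gamma'$ instantiates an axiom. $\tau\overset{\mathcal{MV}}{\sim}\tau'$ means $\tau'$ is reached from $\tau$ by finitely many (possibly zero) steps using axioms of $\mathcal{MV}$. **Substitution graphs.** A substitution graph is a layered graph with a formula $[v]$ at each node: $[v_i^{(0)}]=x_i$, and a node at level $j\ge1$ carries a formula in the variables $x_1,\dots,x_{d_{j-1}}$, $x_{i'}$ referring to the parent $v^{(j-1)}_{i'}$. The represented formula $[\mathcal{G}]$ is obtained from $[v_{\rm out}]$ by simultaneously replacing each $x_{i'}$ by $[v_{i'}^{(L-1)}]$, then in the result each $x_{i'}$ by $[v_{i'}^{(L-2)}]$, and so on down to level $0$. **Extraction.** For a ReLU network $\mathcal{N}$ with integer weights and biases and $[0,1]$-valued on $[0,1]^{d_0}$, $\mathrm{ext}(\mathcal{N})$ is defined as follows. *Step I.* For $j=1,\dots,L-1$ in this order, for each node $v$ of level $j$ compute $\mathcal{L}_v=b_v+\sum_u\max\{w_{v,u},0\}$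 over its (already converted) parents $u$. If $\mathcal{L}_v\le1$, replace its activation by $\sigma$; if $\mathcal{L}_v>1$, replace $v$ by $\lceil\mathcal{L}_v\rceil$ $\sigma$-nodes with the same incoming and outgoing weights and biases $b_v,b_v-1,\dots,b_v-\lceil\mathcal{L}_v\rceil+1$ (nodes of each new level enumerated in a fixed order). Finally apply $\sigma$ at the output node. *Step II.* Each input node gets $x_i$; each non-input node with local map $\sigma(f)$ gets $\mathtt{EXTR}(\sigma(f))$, where for $f=m_1x_1+\dots+m_nx_n+b$ with integer coefficients, with min $\ell$ and max $\mathcal{L}$ over $[0,1]^n$: return $1$ if $\ell\ge1$; return $0$ if $\mathcal{L}\le0$; otherwise let $k$ be the smallest index with $m_k\ne0$; if $m_k\ge1$ return $(\mathtt{EXTR}(\sigma(f-x_k))\oplus x_k)\odot\mathtt{EXTR}(\sigma(f-x_k+1))$; if $m_k\le-1$ return $\lnot\,\mathtt{EXTR}(\sigma(1-f))$; occurrences $0\oplus\tau$ and $\tau\odot1$ produced by the recursion are simplified to $\tau$. $\mathrm{ext}(\mathcal N)$ is the layered graph of the $\sigma$-network from Step I with the node formulae of Step II. **Network derivation.** $\mathcal{N}_1\overset{\mathcal{MV}}{\sim}\mathcal{N}_2$ means $[\mathrm{ext}(\mathcal{N}_1)]\overset{\mathcal{MV}}{\sim}[\mathrm{ext}(\mathcal{N}_2)]$. *)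

theory Defs
  imports Complex_Main
begin

section \<open>Layered networks\<close>

definition relu :: "real \<Rightarrow> real" where
  "relu t = max t 0"

definition clip :: "real \<Rightarrow> real" where
  "clip t = max (min t 1) 0"

definition cube :: "nat \<Rightarrow> real list set" where
  "cube n = {x. length x = n \<and> set x \<subseteq> {0..1}}"

definition affine :: "real list \<Rightarrow> real \<Rightarrow> real list \<Rightarrow> real" where
  "affine ws b x = (\<Sum>i<length ws. ws ! i * x ! i) + b"

text \<open>A node without an activation has \<open>activation = id\<close>. The weights of a node are those of its
  incoming edges, in the order of the nodes of the preceding level.\<close>

datatype node = Node (weights: "real list") (bias: real) (activation: "real \<Rightarrow> real")

text \<open>\<open>layers N ! (j - 1)\<close> is level \<open>j\<close> of the network, for \<open>1 \<le> j \<le> depth N\<close>;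
  level \<open>0\<close> consists of the \<open>inputs N\<close> input nodes. Nodes are indexed from \<open>0\<close> within a level.\<close>

datatype network = Network (inputs: nat) (layers: "node list list")

definition depth :: "network \<Rightarrow> nat" where
  "depth N = length (layers N)"

definition width :: "network \<Rightarrow> nat \<Rightarrow> nat" where
  "width N j = (if j = 0 then inputs N else length (layers N ! (j - 1)))"

definition node_at :: "network \<Rightarrow> nat \<Rightarrow> nat \<Rightarrow> node" where
  "node_at N j i = layers N ! (j - 1) ! i"

definition valid_network :: "network \<Rightarrow> bool" where
  "valid_network N \<longleftrightarrow>
     depth N \<ge> 1 \<and> (\<forall>j\<le>depth N. width N j \<ge> 1) \<and> width N (depth N) = 1 \<and>
     (\<forall>j\<in>{1..depth N}. \<forall>i<width N j. length (weights (node_at N j i)) = width N (j - 1))"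

definition local_map :: "node \<Rightarrow> real list \<Rightarrow> real" where
  "local_map v x = activation v (affine (weights v) (bias v) x)"

fun level_values :: "network \<Rightarrow> nat \<Rightarrow> real list \<Rightarrow> real list" where
  "level_values N 0 x = x"
| "level_values N (Suc j) x = map (\<lambda>v. local_map v (level_values N j x)) (layers N ! j)"

definition global_map :: "network \<Rightarrow> nat \<Rightarrow> nat \<Rightarrow> real list \<Rightarrow> real" where
  "global_map N j i x = level_values N j x ! i"

definition network_map :: "network \<Rightarrow> real list \<Rightarrow> real" where
  "network_map N = global_map N (depth N) 0"

definition relu_network :: "network \<Rightarrow> bool" where
  "relu_network N \<longleftrightarrow>
     valid_network N \<and>
     (\<forall>j\<in>{1..<depth N}. \<forall>i<width N j. activation (node_at N j i) = relu) \<and>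
     activation (node_at N (depth N) 0) = id"

definition integer_network :: "network \<Rightarrow> bool" where
  "integer_network N \<longleftrightarrow>
     (\<forall>j\<in>{1..depth N}. \<forall>i<width N j.
        set (weights (node_at N j i)) \<subseteq> \<int> \<and> bias (node_at N j i) \<in> \<int>)"

text \<open>In the condition on local maps, level \<open>0\<close> is omitted because the local maps of the input
  nodes are the (distinct) coordinate projections.\<close>

definition nondegenerate :: "network \<Rightarrow> bool" where
  "nondegenerate N \<longleftrightarrow>
     (\<forall>j\<in>{1..<depth N}. \<forall>i<width N j. \<exists>x\<in>cube (inputs N). global_map N j i x > 0) \<and>
     (\<forall>j\<in>{1..<depth N}. \<forall>i<width N j. \<exists>x\<in>cube (inputs N). global_map N j i x = 0) \<and>
     (\<forall>j\<in>{1..depth N}. \<forall>i<width N j. \<forall>i'<width N j. i \<noteq> i' \<longrightarrow>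
        (\<exists>y. length y = width N (j - 1) \<and>
             local_map (node_at N j i) y \<noteq> local_map (node_at N j i') y)) \<and>
     (\<forall>j\<in>{1..<depth N}. \<forall>i<width N j. \<exists>i'<width N (j + 1).
        weights (node_at N (j + 1) i') ! i \<noteq> 0)"

definition network_class :: "nat \<Rightarrow> network set" where
  "network_class n =
     {N. relu_network N \<and> nondegenerate N \<and> integer_network N \<and>
         inputs N = n \<and> network_map N ` cube n \<subseteq> {0..1}}"


section \<open>Formulae and derivations\<close>

text \<open>\<open>Var i\<close> is the propositional variable \<open>x\<close> with index \<open>i + 1\<close>.\<close>

datatype fm =
    Var nat
  | Zero
  | One
  | Oplus fm fm (infixl "\<oplus>" 65)
  | Odot fm fm (infixl "\<odot>" 70)
  | Neg fm ("\<^bold>\<not> _" [80] 80)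

primrec subst :: "(nat \<Rightarrow> fm) \<Rightarrow> fm \<Rightarrow> fm" where
  "subst s (Var i) = s i"
| "subst s Zero = Zero"
| "subst s One = One"
| "subst s (p \<oplus> q) = subst s p \<oplus> subst s q"
| "subst s (p \<odot> q) = subst s p \<odot> subst s q"
| "subst s (\<^bold>\<not> p) = \<^bold>\<not> subst s p"

definition mv_axioms :: "(fm \<times> fm) set" where
  "mv_axioms = (let x = Var 0; y = Var 1; z = Var 2 in
    {(x \<oplus> y, y \<oplus> x),
     (x \<odot> y, y \<odot> x),
     (x \<oplus> (y \<oplus> z), (x \<oplus> y) \<oplus> z),
     (x \<odot> (y \<odot> z), (x \<odot> y) \<odot> z),
     (x \<oplus> \<^bold>\<not> x, One),
     (x \<odot> \<^bold>\<not> x, Zero),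
     (x \<oplus> One, One),
     (x \<odot> Zero, Zero),
     (x \<oplus> Zero, x),
     (x \<odot> One, x),
     (\<^bold>\<not> (x \<oplus> y), \<^bold>\<not> x \<odot> \<^bold>\<not> y),
     (\<^bold>\<not> (x \<odot> y), \<^bold>\<not> x \<oplus> \<^bold>\<not> y),
     (x, \<^bold>\<not> (\<^bold>\<not> x)),
     (\<^bold>\<not> Zero, One),
     ((x \<odot> \<^bold>\<not> y) \<oplus> y, (y \<odot> \<^bold>\<not> x) \<oplus> x),
     ((x \<oplus> \<^bold>\<not> y) \<odot> y, (y \<oplus> \<^bold>\<not> x) \<odot> x)})"

definition instantiates :: "fm \<Rightarrow> fm \<Rightarrow> fm \<times> fm \<Rightarrow> bool" where
  "instantiates p q e \<longleftrightarrow>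
     (\<exists>s. (subst s (fst e) = p \<and> subst s (snd e) = q) \<or>
          (subst s (fst e) = q \<and> subst s (snd e) = p))"

inductive step :: "(fm \<times> fm) set \<Rightarrow> fm \<Rightarrow> fm \<Rightarrow> bool" for E where
  here: "e \<in> E \<Longrightarrow> instantiates p q e \<Longrightarrow> step E p q"
| Oplus_left: "step E p q \<Longrightarrow> step E (p \<oplus> r) (q \<oplus> r)"
| Oplus_right: "step E p q \<Longrightarrow> step E (r \<oplus> p) (r \<oplus> q)"
| Odot_left: "step E p q \<Longrightarrow> step E (p \<odot> r) (q \<odot> r)"
| Odot_right: "step E p q \<Longrightarrow> step E (r \<odot> p) (r \<odot> q)"
| Neg: "step E p q \<Longrightarrow> step E (\<^bold>\<not> p) (\<^bold>\<not> q)"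

definition mv_derivable :: "fm \<Rightarrow> fm \<Rightarrow> bool" where
  "mv_derivable = (step mv_axioms)\<^sup>*\<^sup>*"


section \<open>Substitution graphs\<close>

text \<open>A substitution graph is given by its levels \<open>0, \<dots>, L\<close>, each the list of the formulae at its
  nodes; the edges are determined by the level sizes. In a formula at level \<open>j\<close>, \<open>Var i\<close> refers to
  node \<open>i\<close> of level \<open>j - 1\<close>.\<close>

type_synonym subst_graph = "fm list list"

definition replace_vars :: "fm list \<Rightarrow> fm \<Rightarrow> fm" where
  "replace_vars ps = subst (\<lambda>i. if i < length ps then ps ! i else Var i)"

definition represented :: "subst_graph \<Rightarrow> fm" where
  "represented G = fold replace_vars (rev (butlast G)) (hd (last G))"


section \<open>Extraction, Step I\<close>

definition upper :: "node \<Rightarrow> real" where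
  "upper v = bias v + (\<Sum>w\<leftarrow>weights v. max w 0)"

definition copies :: "node \<Rightarrow> nat" where
  "copies v = (if upper v \<le> 1 then 1 else nat \<lceil>upper v\<rceil>)"

definition split_node :: "node \<Rightarrow> node list" where
  "split_node v = map (\<lambda>k. Node (weights v) (bias v - real k) clip) [0..<copies v]"

text \<open>Incoming weights after parent \<open>i\<close> has been replaced by \<open>cs ! i\<close> nodes, all of which inherit
  its outgoing weights. The replacements of a node are enumerated consecutively, in its place.\<close>

definition widen :: "nat list \<Rightarrow> node \<Rightarrow> node" where
  "widen cs v = Node (concat (map2 replicate cs (weights v))) (bias v) (activation v)"

text \<open>The first argument lists, for each node of the preceding level, how many nodes it has become.\<close>

fun convert_layers :: "nat list \<Rightarrow> node list list \<Rightarrow> node list list" where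
  "convert_layers cs [] = []"
| "convert_layers cs [l] =
     [map (\<lambda>v. Node (weights (widen cs v)) (bias v) clip) l]"
| "convert_layers cs (l # l' # ls) =
     (let vs = map (widen cs) l
      in concat (map split_node vs) # convert_layers (map copies vs) (l' # ls))"

definition convert :: "network \<Rightarrow> network" where
  "convert N = Network (inputs N) (convert_layers (replicate (inputs N) 1) (layers N))"


section \<open>Extraction, Step II\<close>

definition int_affine :: "int list \<Rightarrow> int \<Rightarrow> real list \<Rightarrow> real" where
  "int_affine ms b = affine (map real_of_int ms) (real_of_int b)"

text \<open>Minimum and maximum over the cube; both are attained, as the cube is compact.\<close>

definition cube_min :: "int list \<Rightarrow> int \<Rightarrow> real" where
  "cube_min ms b = (INF x\<in>cube (length ms). int_affine ms b x)"

definition cube_max :: "int list \<Rightarrow> int \<Rightarrow> real" where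
  "cube_max ms b = (SUP x\<in>cube (length ms). int_affine ms b x)"

definition first_nonzero :: "int list \<Rightarrow> nat" where
  "first_nonzero ms = (LEAST k. k < length ms \<and> ms ! k \<noteq> 0)"

definition oplus_simp :: "fm \<Rightarrow> fm \<Rightarrow> fm" where
  "oplus_simp p q = (if p = Zero then q else p \<oplus> q)"

definition odot_simp :: "fm \<Rightarrow> fm \<Rightarrow> fm" where
  "odot_simp p q = (if q = One then p else p \<odot> q)"

lemma cube_nonempty: "cube n \<noteq> {}"
proof -
  have "replicate n 0 \<in> cube n" by (auto simp: cube_def)
  then show ?thesis by blast
qed

lemma first_nonzero:
  assumes "\<not> 1 \<le> cube_min ms b" "\<not> cube_max ms b \<le> 0"
  shows "first_nonzero ms < length ms" "ms ! first_nonzero ms \<noteq> 0"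
proof -
  have "\<exists>k. k < length ms \<and> ms ! k \<noteq> 0"
  proof (rule ccontr)
    assume "\<not> ?thesis"
    then have "int_affine ms b x = real_of_int b" for x
      by (simp add: int_affine_def affine_def)
    then have "cube_min ms b = real_of_int b" "cube_max ms b = real_of_int b"
      using cube_nonempty by (simp_all add: cube_min_def cube_max_def)
    with assms show False by simp
  qed
  then have "first_nonzero ms < length ms \<and> ms ! first_nonzero ms \<noteq> 0"
    unfolding first_nonzero_def by (rule LeastI_ex)
  then show "first_nonzero ms < length ms" "ms ! first_nonzero ms \<noteq> 0" by auto
qed

lemma first_nonzero_uminus: "first_nonzero (map uminus ms) = first_nonzero ms"
proof -
  have "(\<lambda>k. k < length (map uminus ms) \<and> map uminus ms ! k \<noteq> 0) =
        (\<lambda>k. k < length ms \<and> ms ! k \<noteq> 0)"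
    by auto
  then show ?thesis by (simp only: first_nonzero_def)
qed

lemma sum_abs_decrease:
  assumes "k < length (ms :: int list)" "1 \<le> ms ! k"
  shows "(\<Sum>m\<leftarrow>ms[k := ms ! k - 1]. nat \<bar>m\<bar>) < (\<Sum>m\<leftarrow>ms. nat \<bar>m\<bar>)"
  using assms
proof (induction ms arbitrary: k)
  case (Cons a ms)
  then show ?case by (cases k) auto
qed simp

text \<open>\<open>extr ms b\<close> is the formula extracted from \<open>clip (ms ! 0 * x ! 0 + ms ! 1 * x ! 1 + \<dots> + b)\<close>.\<close>

function extr :: "int list \<Rightarrow> int \<Rightarrow> fm" where
  "extr ms b =
     (if cube_min ms b \<ge> 1 then One
      else if cube_max ms b \<le> 0 then Zero
      else let k = first_nonzero ms; ms' = ms[k := ms ! k - 1] in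
        if ms ! k \<ge> 1
        then odot_simp (oplus_simp (extr ms' b) (Var k)) (extr ms' (b + 1))
        else \<^bold>\<not> extr (map uminus ms) (1 - b))"
  by pat_completeness auto

termination
proof (relation "measure (\<lambda>(ms, b). 2 * (\<Sum>m\<leftarrow>ms. nat \<bar>m\<bar>) +
    (if ms ! first_nonzero ms < 0 then 1 else 0))", goal_cases)
  case 1
  show ?case by simp
next
  case (2 ms b k ms')
  then show ?case
    using sum_abs_decrease[of k ms] first_nonzero[of ms b] by auto
next
  case (3 ms b k ms')
  then show ?case
    using sum_abs_decrease[of k ms] first_nonzero[of ms b] by auto
next
  case (4 ms b k ms')
  then show ?case
    using first_nonzero[of ms b] by (auto simp: first_nonzero_uminus o_def)
qed

text \<open>As a simplification rule, this equation would loop.\<close>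

declare extr.simps [simp del]

text \<open>The coefficients are integers already in the networks to which this is applied; taking the
  floor only changes their type.\<close>

definition node_formula :: "node \<Rightarrow> fm" where
  "node_formula v = extr (map floor (weights v)) \<lfloor>bias v\<rfloor>"

definition ext :: "network \<Rightarrow> subst_graph" where
  "ext N = map Var [0..<inputs N] # map (map node_formula) (layers (convert N))"

definition network_derivable :: "network \<Rightarrow> network \<Rightarrow> bool" where
  "network_derivable N1 N2 \<longleftrightarrow> mv_derivable (represented (ext N1)) (represented (ext N2))"

end

theory Submission imports Defs begin

text \<open>For every valuation in the cube the extracted formula takes the value of the network: a ReLU node
  whose preactivation is at most \<open>m\<close> is the sum of the \<open>m\<close> clipped nodes with shifted biases, and
  the extraction of a clipped affine function rests on an identity for splitting off one variable.
  Hence the two formulae have the same truth function, and Chang's completeness theorem applies.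
  For the latter, a pair of non-equivalent formulae is separated in the quotient of the Lindenbaum
  algebra by a prime filter, which is an MV-chain and so the unit interval of a totally ordered
  abelian group. Along a valuation there, a formula is an integer linear form whose choice depends
  on the signs of finitely many other forms, and by Fourier-Motzkin elimination these signs also
  occur at a real point.\<close>


section \<open>MV-algebras and their prime filters\<close>

text \<open>The quotient chain may contain infinitesimals, so in general it does not embed in the
  real unit interval. But only finitely many comparisons enter the evaluation of two given formulae,
  and each compares integer linear forms, which make sense in the group of the chain and in the
  reals alike. This is why signs of forms are transported rather than elements. On the network side,
  the output node acquires a clip that the ReLU network does not have; it is harmless because the
  realized function takes values in the unit interval.\<close>

text \<open>The connectives \<open>\<oplus>\<close>, \<open>\<odot>\<close>, \<open>\<not>\<close> are rendered as \<open>+\<close>, \<open>*\<close>, unary \<open>-\<close>.\<close>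

class mv_algebra = comm_monoid_add + comm_monoid_mult + uminus + ord +
  assumes add_one: "x + 1 = 1"
    and neg_neg: "- (- x) = x"
    and times_def: "x * y = - (- x + - y)"
    and one_def: "1 = - 0"
    and join_commute: "x * - y + y = y * - x + x"
    and le_iff: "x \<le> y \<longleftrightarrow> - x + y = 1"
    and less_iff: "x < y \<longleftrightarrow> x \<le> y \<and> \<not> y \<le> x"
begin

lemma neg_one: "- 1 = 0" and neg_zero: "- 0 = 1"
  by (simp_all add: one_def neg_neg)

lemma neg_add: "- (x + y) = - x * - y" and neg_mult: "- (x * y) = - x + - y"
  by (simp_all add: times_def neg_neg)

lemma one_add: "1 + x = 1"
  using add_one[of x] by (simp add: add_commute)

lemma neg_eq_iff: "- x = - y \<longleftrightarrow> x = y"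
  by (metis neg_neg)

lemma mult_zero: "x * 0 = 0" and zero_mult: "0 * x = 0"
  by (simp_all add: times_def neg_zero neg_one one_add add_one)

text \<open>The instance of \<open>join_commute\<close> at \<open>1\<close>: its left side collapses
  to \<open>1\<close>, its right side to \<open>- x + x\<close>.\<close>

lemma neg_add_self: "- x + x = 1"
  using join_commute[of x 1] by (simp add: neg_one mult_zero add_one one_add)

lemma add_neg: "x + - x = 1"
  using neg_add_self[of x] by (simp add: add_commute)

lemma mult_neg: "x * - x = 0"
  by (simp add: times_def neg_neg neg_add_self neg_one)

lemma le_iff_mult: "x \<le> y \<longleftrightarrow> x * - y = 0"
  by (metis le_iff times_def neg_neg neg_one neg_zero)

text \<open>The term \<open>y * - x + x\<close> is the join of \<open>x\<close> and
  \<open>y\<close>, and \<open>join_commute\<close> makes it symmetric; for comparable elements one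
  of its two forms collapses.\<close>

lemma le_add_diff: "x \<le> y \<Longrightarrow> y * - x + x = y"
  using join_commute[of x y] by (simp add: le_iff_mult)

lemma le_add: "x \<le> x + y"
  by (simp add: le_iff add_assoc[symmetric] neg_add_self one_add)

text \<open>The order is the natural one of the additive monoid; through the witness, transitivity
  and monotonicity reduce to associativity.\<close>

lemma le_iff_exists: "x \<le> y \<longleftrightarrow> (\<exists>z. y = x + z)"
  by (metis le_add le_add_diff add_commute)

subclass order
proof
  show "x < y \<longleftrightarrow> x \<le> y \<and> \<not> y \<le> x" for x y by (rule less_iff)
  show "x \<le> x" for x by (simp add: le_iff neg_add_self)
  show "x \<le> z" if "x \<le> y" "y \<le> z" for x y z
    using that by (metis le_iff_exists add_assoc)
  show "x = y" if "x \<le> y" "y \<le> x" for x y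
    using that join_commute[of x y] by (simp add: le_iff_mult)
qed

lemma le_one: "x \<le> 1" and zero_le: "0 \<le> x"
  by (simp_all add: le_iff add_one neg_zero one_add)

lemma one_le_iff: "1 \<le> x \<longleftrightarrow> x = 1"
  by (simp add: le_iff neg_one)

lemma neg_le_neg_iff: "- x \<le> - y \<longleftrightarrow> y \<le> x"
  by (simp add: le_iff neg_neg add_commute)

lemma mv_add_mono:
  assumes "x \<le> y" "z \<le> w"
  shows "x + z \<le> y + w"
proof -
  obtain u v where "y = x + u" "w = z + v"
    using assms by (auto simp: le_iff_exists)
  then have "y + w = (x + z) + (u + v)"
    by (simp add: ac_simps)
  then show ?thesis
    by (simp only: le_add)
qed

lemma mv_mult_mono: "x \<le> y \<Longrightarrow> z \<le> w \<Longrightarrow> x * z \<le> y * w"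
  by (simp add: times_def neg_le_neg_iff mv_add_mono)

text \<open>Residuation: \<open>- y + z\<close> is the implication from \<open>y\<close> to
  \<open>z\<close>.\<close>

lemma mult_le_iff: "x * y \<le> z \<longleftrightarrow> x \<le> - y + z"
  by (simp add: le_iff neg_mult add_assoc)

lemma mult_le: "x * y \<le> x"
  using mv_mult_mono[of x x y 1] le_one by simp

lemma modus_ponens_le: "x * (- x + y) \<le> y"
  by (metis mult_le_iff mult_commute order_refl)

lemma join_least: "x \<le> z \<Longrightarrow> y \<le> z \<Longrightarrow> x * - y + y \<le> z"
  using mv_add_mono[OF mv_mult_mono, of x z "- y" "- y" y y] le_add_diff[of y z] by simp

lemma meet_commute: "x * (- x + y) = y * (- y + x)"
  using join_commute[of "- x" "- y"] neg_eq_iff[of "x * (- x + y)" "y * (- y + x)"]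
  by (simp add: neg_mult neg_add neg_neg add_commute mult_commute)

lemma mult_meet: "x \<le> y \<Longrightarrow> y * (- y + x) = x"
  using meet_commute[of x y] by (simp add: le_iff)

text \<open>\<open>\<forall>z. x \<le> z \<longrightarrow> y \<le> z \<longrightarrow> z = 1\<close> says that the join of \<open>x\<close> and \<open>y\<close> is \<open>1\<close>.\<close>

lemma prelinearity:
  assumes "- x + y \<le> z" "- y + x \<le> z"
  shows "z = 1"
proof -
  \<comment> \<open>\<open>e * (- e + d)\<close> is the meet of the two differences. Three exchanges
    by \<open>meet_commute\<close> bring \<open>y\<close> and \<open>- y\<close> together, so the
    meet vanishes; negated, this says that the join of the two implications \<open>- e\<close> and
    \<open>- d\<close> is \<open>1\<close>.\<close>
  define d e where "d = y * - x" and "e = x * - y"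
  have "e * (- e + d) = - y * (x * (- x + (y + d)))"
    by (simp add: e_def neg_mult neg_neg ac_simps)
  also have "\<dots> = (- y * (- (- y) + d)) * (- (y + d) + x)"
    by (subst meet_commute[of x "y + d"]) (simp add: neg_neg ac_simps)
  also have "\<dots> = y * (- d + - y) * (- x * (- (- x) + (- y * - d)))"
    by (subst meet_commute[of "- y" d]) (simp add: d_def neg_add neg_mult neg_neg ac_simps)
  also have "\<dots> = (y * - y) * (- d + - y) * - d * (- (- y * - d) + - x)"
    by (subst meet_commute[of "- x" "- y * - d"]) (simp add: ac_simps)
  also have "\<dots> = 0"
    by (simp only: mult_neg zero_mult)
  finally have "- (e * (- e + d)) = 1"
    by (simp add: neg_zero)
  then have "- e * - (- d) + - d = 1"
    unfolding join_commute[of "- e" "- d"] by (simp add: neg_mult neg_add neg_neg ac_simps)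
  moreover have "- e \<le> z" "- d \<le> z"
    using assms by (simp_all add: d_def e_def neg_mult neg_neg ac_simps)
  ultimately show ?thesis
    using join_least[of "- e" z "- d"] one_le_iff by simp
qed

text \<open>Residuation moves one factor \<open>y\<close> into the bound: the induction hypothesis
  at \<open>- y + z\<close> gives \<open>y \<le> z\<close>, and the join hypothesis
  finishes.\<close>

lemma join_power_eq_one:
  assumes "\<And>z. x \<le> z \<Longrightarrow> y \<le> z \<Longrightarrow> z = 1" "x \<le> z" "y ^ n \<le> z"
  shows "z = 1"
  using assms(2,3)
proof (induction n arbitrary: z)
  case (Suc n)
  have "y ^ n \<le> - y + z"
    using Suc.prems(2) mult_le_iff[of "y ^ n" y z] by (simp add: mult_commute)
  moreover have "x \<le> - y + z"
    using order_trans[OF Suc.prems(1) le_add[of z "- y"]] by (simp add: add_commute)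
  ultimately have "- y + z = 1"
    using Suc.IH by blast
  then show ?case
    using assms(1)[OF Suc.prems(1)] by (simp add: le_iff)
qed (simp add: one_le_iff)

lemma join_powers_eq_one:
  assumes "\<And>z. x \<le> z \<Longrightarrow> y \<le> z \<Longrightarrow> z = 1" "x ^ m \<le> z" "y ^ n \<le> z"
  shows "z = 1"
proof (rule join_power_eq_one[where x = "y ^ n" and y = x, OF _ assms(3,2)])
  show "z = 1" if "y ^ n \<le> z" "x \<le> z" for z
    using assms(1) that(2,1) by (rule join_power_eq_one)
qed

section \<open>Filters and prime filters\<close>

definition mv_filter :: "'a set \<Rightarrow> bool" where
  "mv_filter F \<longleftrightarrow> 1 \<in> F \<and> (\<forall>x\<in>F. \<forall>y\<in>F. x * y \<in> F) \<and> (\<forall>x\<in>F. \<forall>y. x \<le> y \<longrightarrow> y \<in> F)"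

text \<open>The last condition is linearity of the quotient, as \<open>- x + y\<close> lies in the
  filter iff the class of \<open>x\<close> is below that of \<open>y\<close>.\<close>

definition prime_filter :: "'a set \<Rightarrow> bool" where
  "prime_filter F \<longleftrightarrow> mv_filter F \<and> 0 \<notin> F \<and> (\<forall>x y. - x + y \<in> F \<or> - y + x \<in> F)"

lemma mv_filterD:
  assumes "mv_filter F"
  shows "1 \<in> F" "\<And>x y. x \<in> F \<Longrightarrow> y \<in> F \<Longrightarrow> x * y \<in> F" "\<And>x y. x \<in> F \<Longrightarrow> x \<le> y \<Longrightarrow> y \<in> F"
  using assms unfolding mv_filter_def by blast+

text \<open>The filter generated by \<open>F\<close> and \<open>a\<close>; all powers of
  \<open>a\<close> occur because \<open>*\<close> is not idempotent.\<close>

lemma mv_filter_generated: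
  assumes F: "mv_filter F"
  shows "mv_filter {z. \<exists>f\<in>F. \<exists>n. f * a ^ n \<le> z}" (is "mv_filter ?G")
proof -
  have "1 \<in> ?G"
    using mv_filterD(1)[OF F] le_one by blast
  moreover have "y \<in> ?G" if "x \<in> ?G" "x \<le> y" for x y
    using that order_trans by blast
  moreover have "x * y \<in> ?G" if "x \<in> ?G" "y \<in> ?G" for x y
  proof -
    obtain f m g n where *: "f \<in> F" "g \<in> F" "f * a ^ m \<le> x" "g * a ^ n \<le> y"
      using \<open>x \<in> ?G\<close> \<open>y \<in> ?G\<close> by blast
    then have "(f * g) * a ^ (m + n) \<le> x * y"
      using mv_mult_mono[OF *(3,4)] by (simp add: power_add ac_simps)
    then show ?thesis
      using mv_filterD(2)[OF F *(1,2)] by blast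
  qed
  ultimately show ?thesis
    unfolding mv_filter_def by blast
qed

text \<open>By Zorn there is a filter maximal among those that omit \<open>t\<close>. Adjoining any
  further element \<open>a\<close> yields \<open>t\<close>, that is,
  \<open>f * a ^ n \<le> t\<close> for some \<open>f\<close> in the filter; this forces
  primeness.\<close>

theorem prime_filter_exists:
  assumes "t \<noteq> 1"
  obtains F where "prime_filter F" "t \<notin> F"
proof -
  let ?S = "{F. mv_filter F \<and> t \<notin> F}"
  have one: "{1} \<in> ?S"
    using assms by (auto simp: mv_filter_def one_le_iff)
  have union: "\<Union>C \<in> ?S" if "C \<noteq> {}" "subset.chain ?S C" for C
  proof -
    have C: "mv_filter F" "t \<notin> F" if "F \<in> C" for F
      using that \<open>subset.chain ?S C\<close> unfolding subset.chain_def by auto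
    have "x * y \<in> \<Union>C" if "x \<in> F" "F \<in> C" "y \<in> G" "G \<in> C" for x y F G
    proof -
      have "F \<subseteq> G \<or> G \<subseteq> F"
        using \<open>subset.chain ?S C\<close> \<open>F \<in> C\<close> \<open>G \<in> C\<close> unfolding subset.chain_def by blast
      then show ?thesis
        using that mv_filterD(2)[OF C(1)] by (meson UnionI subsetD)
    qed
    moreover have "1 \<in> \<Union>C"
      using \<open>C \<noteq> {}\<close> mv_filterD(1)[OF C(1)] by blast
    moreover have "y \<in> \<Union>C" if "x \<in> F" "F \<in> C" "x \<le> y" for x y F
      using that mv_filterD(3)[OF C(1)] by (meson UnionI)
    ultimately have "mv_filter (\<Union>C)"
      unfolding mv_filter_def by (meson UnionE)
    then show ?thesis
      using C(2) by simp
  qed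
  have "\<exists>F\<in>?S. \<forall>G\<in>?S. F \<subseteq> G \<longrightarrow> G = F"
  proof (rule subset_Zorn_nonempty)
    show "?S \<noteq> {}"
      using one by (metis empty_iff)
  qed (rule union)
  then obtain F where F: "F \<in> ?S" and max: "\<And>G. G \<in> ?S \<Longrightarrow> F \<subseteq> G \<Longrightarrow> G = F"
    by blast
  have filter: "mv_filter F" and t: "t \<notin> F"
    using F by auto
  have gen: "\<exists>f\<in>F. \<exists>n. f * a ^ n \<le> t" if "a \<notin> F" for a
  proof (rule ccontr)
    let ?G = "{z. \<exists>f\<in>F. \<exists>n. f * a ^ n \<le> z}"
    assume "\<not> ?thesis"
    then have "?G \<in> ?S"
      using mv_filter_generated[OF filter] by simp
    moreover have "F \<subseteq> ?G"
      using mult_le by blast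
    ultimately have "?G = F"
      by (rule max)
    moreover have "a \<in> ?G"
    proof -
      have "1 * a ^ 1 \<le> a"
        by simp
      then show ?thesis
        using mv_filterD(1)[OF filter] by blast
    qed
    ultimately show False
      using that by blast
  qed
  have "- x + y \<in> F \<or> - y + x \<in> F" for x y
  proof (rule ccontr)
    assume "\<not> ?thesis"
    then obtain f m g n where *: "f \<in> F" "g \<in> F" "f * (- x + y) ^ m \<le> t" "g * (- y + x) ^ n \<le> t"
      using gen by meson
    \<comment> \<open>If both implications were missing, powers of both would lie below
      \<open>- (f * g) + t\<close>; their join is \<open>1\<close>, so \<open>f * g \<le> t\<close>
      would put \<open>t\<close> into the filter.\<close>
    have "(- x + y) ^ m \<le> - (f * g) + t" "(- y + x) ^ n \<le> - (f * g) + t"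
      using *(3,4) mult_le[of "f * (- x + y) ^ m" g] mult_le[of "g * (- y + x) ^ n" f]
      unfolding mult_le_iff[symmetric] by (auto simp: ac_simps intro: order_trans)
    then have "- (f * g) + t = 1"
      by (rule join_powers_eq_one[rotated]) (rule prelinearity)
    then have "f * g \<le> t"
      by (simp add: le_iff)
    then show False
      using t mv_filterD(3)[OF filter mv_filterD(2)[OF filter *(1,2)]] by simp
  qed
  moreover have "0 \<notin> F"
    using t mv_filterD(3)[OF filter _ zero_le] by blast
  ultimately have "prime_filter F"
    using filter unfolding prime_filter_def by blast
  then show thesis
    using t that by blast
qed

lemma filter_trans:
  assumes F: "mv_filter F" and "- x + y \<in> F" "- y + z \<in> F"
  shows "- x + z \<in> F"
proof -
  have "(- x + y) * (- y + z) * x \<le> z"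
    using order_trans[OF mv_mult_mono[OF modus_ponens_le order_refl] modus_ponens_le]
    by (simp add: ac_simps)
  then show ?thesis
    using mv_filterD(3)[OF F mv_filterD(2)[OF F assms(2,3)]] by (simp add: mult_le_iff)
qed

text \<open>It is enough to add the same element to both sides, one summand at a time, since
  implications compose by \<open>filter_trans\<close>.\<close>

lemma filter_add:
  assumes F: "mv_filter F" and "- x + y \<in> F" "- z + w \<in> F"
  shows "- (x + z) + (y + w) \<in> F"
proof -
  have *: "- (u + s) + (v + s) \<in> F" if "- u + v \<in> F" for u v s
  proof -
    have "u * (- u + v) + s \<le> v + s"
      by (intro mv_add_mono modus_ponens_le order_refl)
    moreover have "(- u + v) * (u + s) \<le> u * (- u + v) + s"
    proof -
      have "- s * (s + u) \<le> u"
        using modus_ponens_le[of "- s" u] by (simp add: neg_neg)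
      \<comment> \<open>The right side is the join of the left side and \<open>s\<close>.\<close>
      have "(u + s) * (- u + v) \<le> s + (u + s) * (- u + v) * - s"
        using le_add_diff[of s] join_commute[of "(u + s) * (- u + v)" s]
          le_add[of "(u + s) * (- u + v)" "s * - ((u + s) * (- u + v))"]
        by (simp add: ac_simps)
      also have "\<dots> \<le> s + u * (- u + v)"
        using mv_add_mono[OF order_refl mv_mult_mono[OF \<open>- s * (s + u) \<le> u\<close> order_refl], of s "- u + v"]
        by (simp add: ac_simps)
      finally show ?thesis
        by (simp add: ac_simps)
    qed
    ultimately have "(- u + v) \<le> - (u + s) + (v + s)"
      unfolding mult_le_iff[symmetric] by (rule order_trans[rotated])
    then show ?thesis
      by (rule mv_filterD(3)[OF F that])
  qed
  show ?thesis
    using filter_trans[OF F *[OF assms(2), of z] ] *[OF assms(3), of y] by (simp add: add_commute)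
qed

end


section \<open>Chang's group of an MV-chain\<close>

context mv_algebra
begin

text \<open>In the unit interval of an ordered group with unit \<open>u\<close>, the hypotheses say
  that neither sum is truncated, and both sides are \<open>max 0 (a + b + c - u)\<close>. This and
  the next two identities are the cases of associativity in \<open>carry_add_assoc\<close>; they
  have to be proved before the group exists.\<close>

lemma add_mult_swap:
  assumes "a * b = 0" "b * c = 0"
  shows "(a + b) * c = a * (b + c)"
proof -
  have ab: "a \<le> - b"
    using assms by (simp add: le_iff_mult neg_neg)
  have "c = - b * (b + c)"
    using mult_meet[of c "- b"] assms(2) by (simp add: le_iff_mult neg_neg mult_commute)
  then have "(a + b) * c = ((b + a) * - b) * (b + c)"
    by (metis add_commute mult_assoc)
  moreover have "(b + a) * - b = a"
    using mult_meet[OF ab] by (simp add: neg_neg mult_commute)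
  ultimately show ?thesis
    by simp
qed

lemma add_mult_swap_dual:
  assumes "a + b = 1" "b + c = 1"
  shows "a * b + c = a + b * c"
proof -
  have "- ((- a + - b) * - c) = - (- a * (- b + - c))"
    using assms by (subst add_mult_swap) (simp_all add: neg_add[symmetric] neg_one)
  then show ?thesis
    by (simp add: neg_add neg_mult neg_neg)
qed

text \<open>The mixed case: \<open>a + b\<close> does not exceed the unit while \<open>b + c\<close>
  reaches it, and both sides amount to \<open>a + b + c - u\<close>.\<close>

lemma add_mult_exchange:
  assumes "a * b = 0" "b + c = 1"
  shows "(a + b) * c = a + b * c"
proof -
  have ab: "a \<le> - b"
    using assms(1) by (simp add: le_iff_mult neg_neg)
  have cb: "- c \<le> b"
    using assms(2) by (simp add: le_iff neg_neg add_commute)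
  have "b * c + - c = b"
    using le_add_diff[OF cb] by (simp add: neg_neg)
  then have "a + b = (a + b * c) + - c"
    by (simp add: add_assoc)
  moreover have "a + b * c \<le> c"
  proof -
    have "a + b * c \<le> - b + b * c"
      by (rule mv_add_mono[OF ab order_refl])
    also have "\<dots> = c * - (- b) + - b"
      by (simp add: neg_neg ac_simps)
    also have "\<dots> = c"
      using cb by (intro le_add_diff) (simp add: le_iff neg_neg add_commute)
    finally show ?thesis .
  qed
  ultimately show ?thesis
    using mult_meet[of "a + b * c" c] by (simp add: ac_simps)
qed

end

class mv_chain = mv_algebra +
  assumes linear: "x \<le> y \<or> y \<le> x"
    and zero_neq_one: "0 \<noteq> 1"
begin

subclass linorder
  by standard (rule linear)

lemma add_neq_one: "x + y \<noteq> 1 \<Longrightarrow> x * y = 0"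
  using linear[of "- x" y] le_iff[of "- x" y] le_iff_mult[of y "- x"]
  by (simp add: neg_neg mult_commute)

lemma mult_neq_one: "y \<noteq> 1 \<Longrightarrow> x * y \<noteq> 1"
  using mult_le[of y x] one_le_iff[of y] by (metis mult_commute)

end

text \<open>Addition of remainders below the unit: \<open>a + b = 1\<close> means that the truncated
  sum reaches the unit, and \<open>a * b\<close> is then the excess over it.\<close>

fun carry_add :: "int \<times> 'a :: mv_chain \<Rightarrow> int \<times> 'a \<Rightarrow> int \<times> 'a" where
  "carry_add (m, a) (n, b) = (if a + b = 1 then (m + n + 1, a * b) else (m + n, a + b))"

lemma carry_add_assoc:
  fixes a b c :: "'a :: mv_chain"
  assumes "a \<noteq> 1" "c \<noteq> 1"
  shows "carry_add (carry_add (m, a) (n, b)) (k, c) = carry_add (m, a) (carry_add (n, b) (k, c))"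
proof (cases "a + b = 1"; cases "b + c = 1")
  assume "a + b = 1" "b + c = 1"
  then show ?thesis
    by (simp add: add_mult_swap_dual mult.assoc)
next
  assume ab: "a + b = 1" and bc: "b + c \<noteq> 1"
  \<comment> \<open>Exactly one carry arises on either side: the remainder is a product with the
    factor \<open>a\<close>, so \<open>a \<noteq> 1\<close> excludes a second one.\<close>
  have "a * (b + c) = a * b + c"
    using add_mult_exchange[of c b a] add_neq_one[OF bc] ab by (simp add: ac_simps)
  moreover have "a * b + c \<noteq> 1"
    using calculation mult_neq_one[OF \<open>a \<noteq> 1\<close>, of "b + c"] by (simp add: mult.commute)
  moreover have "a + (b + c) = 1"
    using ab by (simp add: add.assoc[symmetric] one_add)
  ultimately show ?thesis
    using ab bc by simp
next
  assume ab: "a + b \<noteq> 1" and bc: "b + c = 1"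
  have "(a + b) * c = a + b * c"
    using add_mult_exchange[of a b c] add_neq_one[OF ab] bc by simp
  moreover have "a + b * c \<noteq> 1"
    using calculation mult_neq_one[OF \<open>c \<noteq> 1\<close>, of "a + b"] by simp
  moreover have "a + b + c = 1"
    using bc by (simp add: add.assoc add_one)
  ultimately show ?thesis
    using ab bc by simp
next
  assume "a + b \<noteq> 1" "b + c \<noteq> 1"
  then show ?thesis
    using add_mult_swap[of a b c] add_neq_one[of a b] add_neq_one[of b c] by (simp add: add.assoc)
qed

fun lex_le :: "int \<times> 'a :: mv_chain \<Rightarrow> int \<times> 'a \<Rightarrow> bool" where
  "lex_le (m, a) (n, b) \<longleftrightarrow> m < n \<or> m = n \<and> a \<le> b"

lemma carry_add_mono:
  fixes a b c :: "'a :: mv_chain"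
  assumes "lex_le (m, a) (n, b)"
  shows "lex_le (carry_add (k, c) (m, a)) (carry_add (k, c) (n, b))"
proof -
  \<comment> \<open>Settles the case where \<open>n = m + 1\<close> and only the smaller pair
    produces a carry, so that the integer parts of the sums agree.\<close>
  have *: "c * a \<le> c + b"
    using order_trans[OF mult_le le_add] .
  show ?thesis
  proof (cases "m = n")
    case True
    then have "a \<le> b"
      using assms by simp
    then have "c + a \<le> c + b" "c * a \<le> c * b"
      by (simp_all add: mv_add_mono mv_mult_mono)
    then show ?thesis
      using True one_le_iff[of "c + b"] by auto
  next
    case False
    then show ?thesis
      using assms * by auto
  qed
qed

text \<open>\<open>(m, a)\<close> stands for \<open>m u + a\<close>, where \<open>u\<close> is the strong unit; \<open>a \<noteq> 1\<close> makes this unique.\<close>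

typedef (overloaded) 'a chang = "{(m :: int, a :: 'a :: mv_chain). a \<noteq> 1}"
  using zero_neq_one by blast

setup_lifting type_definition_chang

instantiation chang :: (mv_chain) linordered_ab_group_add
begin

lift_definition zero_chang :: "'a chang" is "(0, 0)"
  by (simp add: zero_neq_one)

lift_definition plus_chang :: "'a chang \<Rightarrow> 'a chang \<Rightarrow> 'a chang" is
carry_add
  by (auto simp: mult_neq_one split: if_splits)

text \<open>\<open>- (m u + a)\<close> is \<open>(- m - 1) u + (u - a)\<close>, whose remainder is
  below the unit only if \<open>a\<close> is nonzero.\<close>

lift_definition uminus_chang :: "'a chang \<Rightarrow> 'a chang" is
  "\<lambda>(m, a). if a = 0 then (- m, 0) else (- m - 1, - a)"
  by (auto simp: zero_neq_one neg_zero[symmetric] neg_eq_iff split: prod.splits)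

definition minus_chang :: "'a chang \<Rightarrow> 'a chang \<Rightarrow> 'a chang" where
  "minus_chang x y = x + - y"

lift_definition less_eq_chang :: "'a chang \<Rightarrow> 'a chang \<Rightarrow> bool" is lex_le .

definition less_chang :: "'a chang \<Rightarrow> 'a chang \<Rightarrow> bool" where
  "less_chang x y \<longleftrightarrow> x \<le> y \<and> \<not> y \<le> x"

instance
proof
  fix x y z :: "'a chang"
  show "x + y = y + x"
    by transfer (auto simp: ac_simps)
  show "0 + x = x"
    by transfer auto
  show "- x + x = 0"
    by transfer (auto simp: add_neg mult_neg ac_simps zero_neq_one split: if_splits)
  show "x - y = x + - y"
    by (fact minus_chang_def)
  show "x < y \<longleftrightarrow> x \<le> y \<and> \<not> y \<le> x"
    by (fact less_chang_def)
  show "x \<le> x" "x \<le> y \<or> y \<le> x"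
    by (transfer; auto)+
  show "x \<le> y \<Longrightarrow> y \<le> x \<Longrightarrow> x = y" "x \<le> y \<Longrightarrow> y \<le> z \<Longrightarrow> x \<le> z"
    by (transfer; auto)+
  show "x + y + z = x + (y + z)"
  
    by transfer (use carry_add_assoc in blast)
  show "z + x \<le> z + y" if "x \<le> y"
    using that by transfer (use carry_add_mono in blast)
qed

end

lift_definition chang_unit :: "'a :: mv_chain chang" is "(1, 0)"
  by (simp add: zero_neq_one)

text \<open>The top element is no admissible remainder; it becomes the unit with remainder
  \<open>0\<close>.\<close>

lift_definition chang_of :: "'a :: mv_chain \<Rightarrow> 'a chang" is
  "\<lambda>a. if a = 1 then (1, 0) else (0, a)"
  by (simp add: zero_neq_one)

lemma chang_of_eq_iff: "chang_of a = chang_of b \<longleftrightarrow> a = b"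
  by transfer auto

lemma chang_of_zero: "chang_of 0 = 0"
  by transfer (simp add: zero_neq_one)

lemma chang_of_one: "chang_of 1 = chang_unit"
  by transfer simp

lemma chang_of_nonneg: "0 \<le> chang_of a" and chang_of_le: "chang_of a \<le> chang_unit"
  by (transfer; auto simp: zero_le)+

lemma chang_unit_pos: "(0 :: 'a :: mv_chain chang) < chang_unit"
  unfolding less_le by (transfer; simp)

lemma chang_of_add: "chang_of (a + b) = min chang_unit (chang_of a + chang_of b)"
  unfolding min_def
  by transfer (use zero_neq_one zero_le in \<open>auto simp: one_add add_one\<close>)

lemma chang_of_neg: "chang_of (- a) = chang_unit - chang_of a"
proof -
  have "chang_of (- a) + chang_of a = chang_unit"
    by transfer (use zero_neq_one neg_eq_iff[of _ 0] in
      \<open>auto simp: neg_zero neg_one add_neg mult_neg add_one ac_simps\<close>)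
  then show ?thesis
    by (simp add: eq_diff_eq)
qed

lemma chang_of_mult:
  "chang_of (a * b) = max 0 (chang_of a + chang_of b - chang_unit)"
  using linorder_linear[of "chang_of a + chang_of b" chang_unit]
  by (auto simp: times_def chang_of_neg chang_of_add min_def max_def algebra_simps)


section \<open>Integer linear forms over ordered groups\<close>

text \<open>Multiples in an arbitrary abelian group, so that one integer form can be evaluated both
  in a Chang group and in the reals.\<close>

definition zmult :: "int \<Rightarrow> 'g :: ab_group_add \<Rightarrow> 'g" where
  "zmult k g = (if k \<ge> 0 then ((+) g ^^ nat k) 0 else - ((+) g ^^ nat (- k)) 0)"

lemma zmult_succ: "zmult (k + 1) g = zmult k g + g"
proof (cases "k \<ge> 0")
  case True
  then show ?thesis
    by (simp add: zmult_def nat_add_distrib add.commute)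
next
  case False
  then obtain m where "nat (- k) = Suc m" "nat (- (k + 1)) = m"
    by (cases "nat (- k)") auto
  moreover have "k + 1 < 0 \<or> k = - 1" "\<not> k \<ge> 0"
    using False by auto
  ultimately show ?thesis
    by (auto simp: zmult_def)
qed

lemma zmult_zero [simp]: "zmult 0 g = 0" and zmult_one [simp]: "zmult 1 g = g"
  using zmult_succ[of 0 g] by (simp_all add: zmult_def)

lemma zmult_add: "zmult (j + k) g = zmult j g + zmult k g"
proof (induction k rule: int_induct[of _ 0])
  case (step1 k)
  then show ?case
    using zmult_succ[of "j + k" g] zmult_succ[of k g] by (simp add: ac_simps)
next
  case (step2 k)
  then show ?case
    using zmult_succ[of "j + (k - 1)" g] zmult_succ[of "k - 1" g]
    by (simp add: algebra_simps)
qed simp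

lemma zmult_uminus: "zmult (- k) g = - zmult k g"
  using zmult_add[of k "- k" g] by (simp add: eq_neg_iff_add_eq_0 add.commute)

lemma zmult_diff: "zmult (j - k) g = zmult j g - zmult k g"
  using zmult_add[of j "- k" g] by (simp add: zmult_uminus)

lemma zmult_zmult: "zmult j (zmult k g) = zmult (j * k) g"
proof (induction j rule: int_induct[of _ 0])
  case (step1 j)
  then show ?case by (simp add: zmult_succ zmult_add algebra_simps)
next
  case (step2 j)
  then show ?case by (simp add: zmult_diff algebra_simps)
qed simp

lemma zmult_add_right: "zmult j (g + h) = zmult j g + zmult j h"
proof (induction j rule: int_induct[of _ 0])
  case (step1 j)
  then show ?case by (simp add: zmult_add algebra_simps)
next
  case (step2 j)
  then show ?case by (simp add: zmult_diff algebra_simps)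
qed simp

lemma zmult_zero_right [simp]: "zmult j 0 = 0"
  using zmult_add_right[of j 0 0] by simp

lemma zmult_sum: "zmult j (sum f A) = (\<Sum>i\<in>A. zmult j (f i))"
  by (induction A rule: infinite_finite_induct) (simp_all add: zmult_add_right)

lemma zmult_real: "zmult k (x :: real) = of_int k * x"
proof (induction k rule: int_induct[of _ 0])
  case (step1 j)
  then show ?case by (simp add: zmult_add algebra_simps)
next
  case (step2 j)
  then show ?case by (simp add: zmult_diff algebra_simps)
qed simp

lemma zmult_pos:
  fixes g :: "'g :: linordered_ab_group_add"
  assumes "0 < k" "0 < g"
  shows "0 < zmult k g"
  using assms
proof (induction k rule: int_gr_induct)
  case base
  then show ?case using assms(2) zmult_succ[of 0 g] by simp
next
  case (step i)
  then show ?case by (simp add: zmult_succ add_pos_pos)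
qed

lemma zmult_uminus_right: "zmult j (- g) = - zmult j g"
  using zmult_add_right[of j g "- g"] by (simp add: eq_neg_iff_add_eq_0 add.commute)

lemma zmult_sign:
  fixes g :: "'g :: linordered_ab_group_add"
  assumes "0 < k"
  shows "0 < zmult k g \<longleftrightarrow> 0 < g" "zmult k g < 0 \<longleftrightarrow> g < 0"
  using zmult_pos[OF assms, of g] zmult_pos[OF assms, of "- g"]
  by (cases g "0 :: 'g" rule: linorder_cases; force simp: zmult_uminus_right)+

definition lin :: "nat \<Rightarrow> (nat \<Rightarrow> int) \<Rightarrow> (nat \<Rightarrow> 'g :: ab_group_add) \<Rightarrow> 'g" where
  "lin k f g = (\<Sum>i<k. zmult (f i) (g i))"

lemma lin_Suc: "lin (Suc k) f g = lin k f g + zmult (f k) (g k)"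
  by (simp add: lin_def)

lemma lin_add: "lin k (\<lambda>i. f i + h i) g = lin k f g + lin k h g"
  by (simp add: lin_def zmult_add sum.distrib)

lemma lin_diff: "lin k (\<lambda>i. f i - h i) g = lin k f g - lin k h g"
  by (simp add: lin_def zmult_diff sum_subtractf)

lemma lin_uminus: "lin k (\<lambda>i. - f i) g = - lin k f g"
  by (simp add: lin_def zmult_uminus sum_negf)

lemma lin_scale: "lin k (\<lambda>i. c * f i) g = zmult c (lin k f g)"
  by (simp add: lin_def zmult_sum zmult_zmult)

lemma lin_cong: "(\<And>i. i < k \<Longrightarrow> g i = h i) \<Longrightarrow> lin k f g = lin k f h"
  by (simp add: lin_def)

lemma lin_unit: "j < k \<Longrightarrow> lin k (\<lambda>i. if i = j then 1 else 0) g = g j"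
  by (simp add: lin_def if_distrib[of "\<lambda>k. zmult k _"] cong: if_cong)

section \<open>Realizing sign patterns of linear forms at real points\<close>

definition same_sign :: "'g :: linordered_ab_group_add \<Rightarrow> 'h :: linordered_ab_group_add \<Rightarrow> bool" where
  "same_sign a b \<longleftrightarrow> (0 < a \<longleftrightarrow> 0 < b) \<and> (a < 0 \<longleftrightarrow> b < 0)"

lemma same_sign_uminus: "same_sign (- a) (- b) \<longleftrightarrow> same_sign a b"
  by (auto simp: same_sign_def)

text \<open>The choice of the last coordinate in the elimination: the value prescribed by
  \<open>E\<close> if there is one, otherwise density between \<open>L\<close> and \<open>H\<close>,
  or unboundedness when a side is empty.\<close>

lemma real_interpolation:
  fixes L E H :: "real set"
  assumes "finite L" "finite H"
    and "\<And>l h. l \<in> L \<Longrightarrow> h \<in> H \<Longrightarrow> l < h" "\<And>l e. l \<in> L \<Longrightarrow> e \<in> E \<Longrightarrow> l < e"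
    and "\<And>e h. e \<in> E \<Longrightarrow> h \<in> H \<Longrightarrow> e < h" "\<And>e e'. e \<in> E \<Longrightarrow> e' \<in> E \<Longrightarrow> e = e'"
  shows "\<exists>t. (\<forall>l\<in>L. l < t) \<and> (\<forall>e\<in>E. e = t) \<and> (\<forall>h\<in>H. t < h)"
proof (cases "E = {}")
  case False
  then show ?thesis
    using assms(4-6) by blast
next
  case True
  show ?thesis
  proof (cases "L = {}"; cases "H = {}")
    assume "L = {}" "H = {}"
    then show ?thesis using True by simp
  next
    assume "H = {}"
    have "\<forall>l\<in>L. l < Max L + 1"
      using Max_ge[OF assms(1)] by (auto intro: le_less_trans[OF _ less_add_one])
    then show ?thesis using True \<open>H = {}\<close> by blast
  next
    assume "L = {}"
    have "\<forall>h\<in>H. Min H - 1 < h"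
      using Min_le[OF assms(2)] by (auto intro: less_le_trans[of "Min H - 1" "Min H"])
    then show ?thesis using True \<open>L = {}\<close> by blast
  next
    assume "L \<noteq> {}" "H \<noteq> {}"
    then have "Max L < Min H"
      using assms(1-3) by simp
    then obtain t where "Max L < t" "t < Min H"
      using dense by blast
    then show ?thesis
      using True le_less_trans[OF Max_ge[OF assms(1)]] less_le_trans[OF _ Min_le[OF assms(2)]]
      by (intro exI[of _ t]) blast
  qed
qed

text \<open>Fourier-Motzkin elimination of the last variable.\<close>

lemma same_sign_real_point:
  fixes g :: "nat \<Rightarrow> 'g :: linordered_ab_group_add"
  assumes "finite W"
  shows "\<exists>x :: nat \<Rightarrow> real. \<forall>f\<in>W. same_sign (lin k f g) (lin k f x)"
  using assms
proof (induction k arbitrary: W)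
  case 0
  then show ?case by (simp add: lin_def same_sign_def)
next
  case (Suc k)
  \<comment> \<open>Closed under negation, so that every form of \<open>W\<close> with nonzero last
    coefficient is in \<open>P\<close> up to sign.\<close>
  define S where "S = W \<union> (\<lambda>f i. - f i) ` W"
  define P where "P = {f \<in> S. f k > 0}"
  \<comment> \<open>The last coefficient of each combination cancels; \<open>W\<close> is kept for
    those of its forms that do not contain the last variable.\<close>
  define R where "R = (\<lambda>(f, h) i. f k * h i - h k * f i) ` (P \<times> P) \<union> W"
  have "finite S" "finite P"
    using Suc.prems by (simp_all add: S_def P_def)
  then have "finite R"
    using Suc.prems by (simp add: R_def)
  then obtain x :: "nat \<Rightarrow> real" where x: "\<And>f. f \<in> R \<Longrightarrow> same_sign (lin k f g) (lin k f x)"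
    using Suc.IH by blast
  \<comment> \<open>The value of the last variable at which \<open>f\<close> vanishes, the others
    being taken from \<open>x\<close>. The group has no division, so there the comparison of two
    roots becomes the sign of a cross-multiplied difference.\<close>
  define root where "root f = - lin k f x / of_int (f k)" for f
  have root: "same_sign (zmult (f k) (lin (Suc k) h g) - zmult (h k) (lin (Suc k) f g)) (root f - root h)"
    if "f \<in> P" "h \<in> P" for f h
  proof -
    let ?r = "\<lambda>i. f k * h i - h k * f i"
    have "lin k ?r g = zmult (f k) (lin (Suc k) h g) - zmult (h k) (lin (Suc k) f g)"
      by (simp add: lin_diff lin_scale lin_Suc zmult_add_right zmult_zmult
          mult.commute[of "h k" "f k"])
    moreover have "lin k ?r x = of_int (f k) * of_int (h k) * (root f - root h)"
      unfolding lin_diff lin_scale using that by (simp add: P_def root_def zmult_real field_simps)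
    moreover have "?r \<in> R"
      using that by (auto simp: R_def)
    moreover have "0 < (of_int (f k) * of_int (h k) :: real)"
      using that by (simp add: P_def)
    ultimately show ?thesis
      using x[of ?r] by (auto simp: same_sign_def zero_less_mult_iff mult_less_0_iff)
  qed
  have root_less: "root f < root h"
    if "f \<in> P" "h \<in> P" and *: "lin (Suc k) h g \<le> 0" "0 \<le> lin (Suc k) f g"
      "lin (Suc k) h g < lin (Suc k) f g" for f h
  proof -
    have "zmult (f k) (lin (Suc k) h g) - zmult (h k) (lin (Suc k) f g) < 0"
    proof (cases "lin (Suc k) f g = 0")
      case True
      then show ?thesis
        using that zmult_sign[of "f k" "lin (Suc k) h g"] by (simp add: P_def)
    next
      case False
      then have "0 < zmult (h k) (lin (Suc k) f g)"
        using that zmult_sign[of "h k" "lin (Suc k) f g"] by (simp add: P_def)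
      moreover have "zmult (f k) (lin (Suc k) h g) \<le> 0"
        using that zmult_sign(1)[of "f k" "lin (Suc k) h g"] by (simp add: P_def flip: not_less)
      ultimately show ?thesis
        by simp
    qed
    then show ?thesis
      using root[OF that(1,2)] by (simp add: same_sign_def)
  qed
  have root_eq: "root f = root h"
    if "f \<in> P" "h \<in> P" "lin (Suc k) h g = 0" "lin (Suc k) f g = 0" for f h
    using root[OF that(1,2)] that(3,4) by (simp add: same_sign_def)
  \<comment> \<open>The last coefficient being positive, \<open>f\<close> is positive exactly above
    its root; so its sign at \<open>g\<close> prescribes on which side of the root the last
    coordinate has to lie.\<close>
  define L E H where "L = root ` {f \<in> P. 0 < lin (Suc k) f g}"
    and "E = root ` {f \<in> P. lin (Suc k) f g = 0}" and "H = root ` {f \<in> P. lin (Suc k) f g < 0}"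
  have "\<exists>t. (\<forall>l\<in>L. l < t) \<and> (\<forall>e\<in>E. e = t) \<and> (\<forall>h\<in>H. t < h)"
  proof (rule real_interpolation)
    show "finite L" "finite H"
      using \<open>finite P\<close> by (simp_all add: L_def H_def)
  next
    fix l h assume "l \<in> L" "h \<in> H"
    then show "l < h"
      unfolding L_def E_def H_def by (auto intro!: root_less)
  next
    fix l h assume "l \<in> L" "h \<in> E"
    then show "l < h"
      unfolding L_def E_def H_def by (auto intro!: root_less)
  next
    fix l h assume "l \<in> E" "h \<in> H"
    then show "l < h"
      unfolding L_def E_def H_def by (auto intro!: root_less)
  next
    fix l h assume "l \<in> E" "h \<in> E"
    then show "l = h"
      unfolding L_def E_def H_def by (auto intro!: root_eq)
  qed
  then obtain t where t: "\<forall>l\<in>L. l < t" "\<forall>e\<in>E. e = t" "\<forall>h\<in>H. t < h"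
    by blast
  have sign: "same_sign (lin (Suc k) f g) (lin (Suc k) f (x(k := t)))" if "f \<in> P" for f
  proof -
    have "lin (Suc k) f (x(k := t)) = of_int (f k) * (t - root f)"
      using that by (simp add: P_def lin_Suc root_def zmult_real field_simps lin_cong[of k "x(k := t)" x])
    moreover have "0 < (of_int (f k) :: real)"
      using that by (simp add: P_def)
    ultimately show ?thesis
      using t that unfolding L_def E_def H_def
      by (cases "lin (Suc k) f g" "0 :: 'g" rule: linorder_cases)
        (auto simp: same_sign_def zero_less_mult_iff mult_less_0_iff)
  qed
  have "same_sign (lin (Suc k) f g) (lin (Suc k) f (x(k := t)))" if "f \<in> W" for f
  proof (cases "f k" "0 :: int" rule: linorder_cases)
    case less
    then have "(\<lambda>i. - f i) \<in> P"
      using that by (simp add: P_def S_def)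
    from sign[OF this] show ?thesis
      by (simp only: lin_uminus same_sign_uminus)
  next
    case equal
    then show ?thesis
      using x[of f] that by (simp add: lin_Suc R_def lin_cong[of k "x(k := t)" x])
  next
    case greater
    then show ?thesis
      using that by (intro sign) (simp add: P_def S_def)
  qed
  then show ?case
    by blast
qed


section \<open>Evaluation of formulae\<close>

primrec mv_eval :: "(nat \<Rightarrow> 'a :: mv_algebra) \<Rightarrow> fm \<Rightarrow> 'a" where
  "mv_eval v (Var i) = v i"
| "mv_eval v Zero = 0"
| "mv_eval v One = 1"
| "mv_eval v (p \<oplus> q) = mv_eval v p + mv_eval v q"
| "mv_eval v (p \<odot> q) = mv_eval v p * mv_eval v q"
| "mv_eval v (\<^bold>\<not> p) = - mv_eval v p"

text \<open>The truth function in the unit interval \<open>[0, u]\<close> of an ordered group.\<close>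

primrec eval :: "'g :: linordered_ab_group_add \<Rightarrow> (nat \<Rightarrow> 'g) \<Rightarrow> fm \<Rightarrow> 'g" where
  "eval u v (Var i) = v i"
| "eval u v Zero = 0"
| "eval u v One = u"
| "eval u v (p \<oplus> q) = min u (eval u v p + eval u v q)"
| "eval u v (p \<odot> q) = max 0 (eval u v p + eval u v q - u)"
| "eval u v (\<^bold>\<not> p) = u - eval u v p"

lemma chang_of_mv_eval: "chang_of (mv_eval v p) = eval chang_unit (\<lambda>i. chang_of (v i)) p"
  by (induction p) (simp_all add: chang_of_zero chang_of_one chang_of_add chang_of_mult chang_of_neg)

text \<open>The real points found by elimination give the unit an arbitrary positive value; division
  by it normalizes the valuation.\<close>

lemma eval_scale:
  fixes u :: real
  assumes "0 < u"
  shows "eval u v p = u * eval 1 (\<lambda>i. v i / u) p"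
  using assms
proof (induction p)
  case (Oplus p q)
  then show ?case
    using min_mult_distrib_left[of u 1 "eval 1 (\<lambda>i. v i / u) p + eval 1 (\<lambda>i. v i / u) q"]
    by (simp add: algebra_simps)
next
  case (Odot p q)
  then show ?case
    using max_mult_distrib_left[of u 0 "eval 1 (\<lambda>i. v i / u) p + eval 1 (\<lambda>i. v i / u) q - 1"]
    by (simp add: algebra_simps)
qed (simp_all add: algebra_simps)

primrec var_bound :: "fm \<Rightarrow> nat" where
  "var_bound (Var i) = Suc i"
| "var_bound Zero = 0"
| "var_bound One = 0"
| "var_bound (p \<oplus> q) = max (var_bound p) (var_bound q)"
| "var_bound (p \<odot> q) = max (var_bound p) (var_bound q)"
| "var_bound (\<^bold>\<not> p) = var_bound p"

text \<open>Coordinate \<open>0\<close> carries the unit, coordinate \<open>i + 1\<close> the variable \<open>i\<close>.\<close>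

lemma eval_locally_linear:
  fixes g :: "nat \<Rightarrow> 'g :: linordered_ab_group_add"
  assumes "var_bound p \<le> k"
  shows "\<exists>f W. finite W \<and> lin (Suc k) f g = eval (g 0) (\<lambda>i. g (Suc i)) p \<and>
    (\<forall>x :: nat \<Rightarrow> real. (\<forall>h\<in>W. same_sign (lin (Suc k) h g) (lin (Suc k) h x)) \<longrightarrow>
      lin (Suc k) f x = eval (x 0) (\<lambda>i. x (Suc i)) p)"
  using assms
proof (induction p)
  case (Var i)
  then show ?case
    by (intro exI[of _ "\<lambda>j. if j = Suc i then 1 else 0"] exI[of _ "{}"]) (simp add: lin_unit)
next
  case Zero
  show ?case
    by (intro exI[of _ "\<lambda>j. 0"] exI[of _ "{}"]) (simp add: lin_def)
next
  case One
  show ?case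
    by (intro exI[of _ "\<lambda>j. if j = 0 then 1 else 0"] exI[of _ "{}"]) (simp add: lin_unit)
next
  case (Neg p)
  then obtain f W where f: "finite W" "lin (Suc k) f g = eval (g 0) (\<lambda>i. g (Suc i)) p"
    "\<And>x :: nat \<Rightarrow> real. \<forall>h\<in>W. same_sign (lin (Suc k) h g) (lin (Suc k) h x) \<Longrightarrow>
      lin (Suc k) f x = eval (x 0) (\<lambda>i. x (Suc i)) p"
    by auto
  then show ?case
    by (intro exI[of _ "\<lambda>j. (if j = 0 then 1 else 0) - f j"] exI[of _ W])
      (simp add: lin_diff lin_unit)
next
  case (Oplus p q)
  then obtain f W f' W' where f: "finite W" "lin (Suc k) f g = eval (g 0) (\<lambda>i. g (Suc i)) p"
    "\<And>x :: nat \<Rightarrow> real. \<forall>h\<in>W. same_sign (lin (Suc k) h g) (lin (Suc k) h x) \<Longrightarrow>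
      lin (Suc k) f x = eval (x 0) (\<lambda>i. x (Suc i)) p"
    and f': "finite W'" "lin (Suc k) f' g = eval (g 0) (\<lambda>i. g (Suc i)) q"
    "\<And>x :: nat \<Rightarrow> real. \<forall>h\<in>W'. same_sign (lin (Suc k) h g) (lin (Suc k) h x) \<Longrightarrow>
      lin (Suc k) f' x = eval (x 0) (\<lambda>i. x (Suc i)) q"
    by auto
  define e where "e = (\<lambda>j :: nat. if j = 0 then 1 else 0 :: int)"
  \<comment> \<open>The sign of \<open>d\<close> at \<open>g\<close> decides the branch of the
    \<open>min\<close>, and likewise of the \<open>max\<close> in the case of
    \<open>\<odot>\<close>. With \<open>d\<close> among the controlled forms, a real point with the
    same signs takes the same branch.\<close>
  define d where "d = (\<lambda>j. (f j + f' j) - e j)"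
  define s where "s = (if lin (Suc k) d g < 0 then (\<lambda>j. f j + f' j) else e)"
  have e: "lin (Suc k) e z = z 0" for z :: "nat \<Rightarrow> 'h :: ab_group_add"
    by (simp add: e_def lin_unit)
  have "lin (Suc k) s g = eval (g 0) (\<lambda>i. g (Suc i)) (p \<oplus> q)"
    using f(2) f'(2) by (auto simp: s_def d_def lin_diff lin_add e min_def)
  moreover have "lin (Suc k) s x = eval (x 0) (\<lambda>i. x (Suc i)) (p \<oplus> q)"
    if "\<forall>h\<in>insert d (W \<union> W'). same_sign (lin (Suc k) h g) (lin (Suc k) h x)"
    for x :: "nat \<Rightarrow> real"
    using that f(3)[of x] f'(3)[of x]
    by (auto simp: s_def d_def lin_diff lin_add e min_def same_sign_def)
  moreover have "finite (insert d (W \<union> W'))"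
    using f(1) f'(1) by simp
  ultimately show ?case
    by blast
next
  case (Odot p q)
  then obtain f W f' W' where f: "finite W" "lin (Suc k) f g = eval (g 0) (\<lambda>i. g (Suc i)) p"
    "\<And>x :: nat \<Rightarrow> real. \<forall>h\<in>W. same_sign (lin (Suc k) h g) (lin (Suc k) h x) \<Longrightarrow>
      lin (Suc k) f x = eval (x 0) (\<lambda>i. x (Suc i)) p"
    and f': "finite W'" "lin (Suc k) f' g = eval (g 0) (\<lambda>i. g (Suc i)) q"
    "\<And>x :: nat \<Rightarrow> real. \<forall>h\<in>W'. same_sign (lin (Suc k) h g) (lin (Suc k) h x) \<Longrightarrow>
      lin (Suc k) f' x = eval (x 0) (\<lambda>i. x (Suc i)) q"
    by auto
  define e where "e = (\<lambda>j :: nat. if j = 0 then 1 else 0 :: int)"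
  define d where "d = (\<lambda>j. (f j + f' j) - e j)"
  define s where "s = (if lin (Suc k) d g < 0 then (\<lambda>j. 0) else d)"
  have e: "lin (Suc k) e z = z 0" "lin (Suc k) (\<lambda>j. 0) z = 0"
    for z :: "nat \<Rightarrow> 'h :: ab_group_add"
    by (simp add: e_def lin_unit, simp add: lin_def)
  have "lin (Suc k) s g = eval (g 0) (\<lambda>i. g (Suc i)) (p \<odot> q)"
    using f(2) f'(2) by (auto simp: s_def d_def lin_diff lin_add e max_def)
  moreover have "lin (Suc k) s x = eval (x 0) (\<lambda>i. x (Suc i)) (p \<odot> q)"
    if "\<forall>h\<in>insert d (W \<union> W'). same_sign (lin (Suc k) h g) (lin (Suc k) h x)"
    for x :: "nat \<Rightarrow> real"
    using that f(3)[of x] f'(3)[of x]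
    by (auto simp: s_def d_def lin_diff lin_add e max_def same_sign_def)
  moreover have "finite (insert d (W \<union> W'))"
    using f(1) f'(1) by simp
  ultimately show ?case
    by blast
qed

definition valid_equation :: "fm \<Rightarrow> fm \<Rightarrow> bool" where
  "valid_equation p q \<longleftrightarrow> (\<forall>v :: nat \<Rightarrow> real. range v \<subseteq> {0..1} \<longrightarrow> eval 1 v p = eval 1 v q)"

text \<open>A failure in the chain is a failure in its Chang group, which is witnessed by the signs of
  finitely many linear forms; a real point with the same signs, scaled to unit \<open>1\<close>, is a
  counterexample over the reals.\<close>

theorem chain_valid:
  fixes w :: "nat \<Rightarrow> 'a :: mv_chain"
  assumes "valid_equation p q"
  shows "mv_eval w p = mv_eval w q"
proof (rule ccontr)
  define g where "g = case_nat chang_unit (\<lambda>i. chang_of (w i))"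
  define k where "k = max (var_bound p) (var_bound q)"
  define e where "e j = (\<lambda>i. if i = j then 1 else 0 :: int)" for j :: nat
  assume "mv_eval w p \<noteq> mv_eval w q"
  then have neq: "eval (g 0) (\<lambda>i. g (Suc i)) p \<noteq> eval (g 0) (\<lambda>i. g (Suc i)) q"
    by (simp add: g_def flip: chang_of_mv_eval) (simp add: chang_of_eq_iff)
  obtain f W where f: "finite W" "lin (Suc k) f g = eval (g 0) (\<lambda>i. g (Suc i)) p"
    "\<And>x :: nat \<Rightarrow> real. \<forall>h\<in>W. same_sign (lin (Suc k) h g) (lin (Suc k) h x) \<Longrightarrow>
      lin (Suc k) f x = eval (x 0) (\<lambda>i. x (Suc i)) p"
    using eval_locally_linear[of p k g] by (auto simp: k_def)
  obtain f' W' where f': "finite W'" "lin (Suc k) f' g = eval (g 0) (\<lambda>i. g (Suc i)) q"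
    "\<And>x :: nat \<Rightarrow> real. \<forall>h\<in>W'. same_sign (lin (Suc k) h g) (lin (Suc k) h x) \<Longrightarrow>
      lin (Suc k) f' x = eval (x 0) (\<lambda>i. x (Suc i)) q"
    using eval_locally_linear[of q k g] by (auto simp: k_def)
  \<comment> \<open>Besides the forms controlling the two evaluations: their difference, to preserve
    the inequality, and the forms that place every coordinate between \<open>0\<close> and the unit,
    which is positive by \<open>e 0\<close>.\<close>
  define U where "U = W \<union> W' \<union> {\<lambda>i. f i - f' i} \<union> e ` {..k} \<union> (\<lambda>j i. e 0 i - e j i) ` {..k}"
  have "finite U"
    using f(1) f'(1) by (simp add: U_def)
  then obtain y :: "nat \<Rightarrow> real" where y: "\<And>h. h \<in> U \<Longrightarrow> same_sign (lin (Suc k) h g) (lin (Suc k) h y)"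
    using same_sign_real_point[of U "Suc k" g] by blast
  \<comment> \<open>Coordinates beyond \<open>k\<close> do not affect the forms; the default
    \<open>0\<close> keeps the valuation in the unit interval.\<close>
  define x where "x i = (if i \<le> k then y i else 0)" for i
  have x: "same_sign (lin (Suc k) h g) (lin (Suc k) h x)" if "h \<in> U" for h
    using y[OF that] lin_cong[of "Suc k" x y h] by (simp add: x_def)
  have e: "lin (Suc k) (e j) z = z j" if "j \<le> k" for j and z :: "nat \<Rightarrow> 'h :: ab_group_add"
    using that by (simp add: e_def lin_unit)
  have "0 < x 0"
    using x[of "e 0"] chang_unit_pos[where 'a = 'a] by (simp add: U_def e same_sign_def g_def)
  have nonneg: "0 \<le> x j" and le: "x j \<le> x 0" for j
  proof -
    have "0 \<le> x j \<and> x j \<le> x 0" if "j \<le> k"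
    proof -
      have "0 \<le> g j" "g j \<le> g 0"
        using chang_unit_pos[where 'a = 'a]
        by (auto simp: g_def chang_of_nonneg chang_of_le less_imp_le split: nat.split)
      then show ?thesis
        using that x[of "e j"] x[of "\<lambda>i. e 0 i - e j i"]
        by (auto simp: U_def e lin_diff same_sign_def not_less[symmetric])
    qed
    then show "0 \<le> x j" "x j \<le> x 0"
      using \<open>0 < x 0\<close> by (auto simp: x_def)
  qed
  have "lin (Suc k) f x = eval (x 0) (\<lambda>i. x (Suc i)) p"
    using x by (intro f(3)) (simp add: U_def)
  moreover have "lin (Suc k) f' x = eval (x 0) (\<lambda>i. x (Suc i)) q"
    using x by (intro f'(3)) (simp add: U_def)
  moreover have "lin (Suc k) f x \<noteq> lin (Suc k) f' x"
    using x[of "\<lambda>i. f i - f' i"] neq f(2) f'(2)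
    by (auto simp: U_def lin_diff same_sign_def neq_iff)
  moreover have "range (\<lambda>i. x (Suc i) / x 0) \<subseteq> {0..1}"
    using \<open>0 < x 0\<close> nonneg le by auto
  then have "eval 1 (\<lambda>i. x (Suc i) / x 0) p = eval 1 (\<lambda>i. x (Suc i) / x 0) q"
    using assms unfolding valid_equation_def by blast
  ultimately show False
    using eval_scale[OF \<open>0 < x 0\<close>, of "\<lambda>i. x (Suc i)"] by simp
qed

section \<open>The completeness theorem for the MV axioms\<close>

text \<open>\<open>instantiates\<close> admits an axiom in both orientations.\<close>

lemma step_sym: "step E p q \<Longrightarrow> step E q p"
proof (induction rule: step.induct)
  case (here e p q)
  then show ?case
    using step.here[of e E q p] by (auto simp: instantiates_def)
qed (auto intro: step.intros)

lemma mv_derivable_context: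
  assumes "mv_derivable p q" "\<And>p q. step mv_axioms p q \<Longrightarrow> step mv_axioms (c p) (c q)"
  shows "mv_derivable (c p) (c q)"
  using assms(1) unfolding mv_derivable_def
  by (induction rule: rtranclp_induct) (auto intro: assms(2) rtranclp.rtrancl_into_rtrancl)

lemma mv_derivable_refl: "mv_derivable p p"
  and mv_derivable_trans: "mv_derivable p q \<Longrightarrow> mv_derivable q r \<Longrightarrow> mv_derivable p r"
  by (auto simp: mv_derivable_def)

lemma mv_derivable_sym: "mv_derivable p q \<Longrightarrow> mv_derivable q p"
  unfolding mv_derivable_def
  by (induction rule: rtranclp_induct) (auto intro: step_sym converse_rtranclp_into_rtranclp)

lemma mv_derivable_Oplus:
  "mv_derivable p p' \<Longrightarrow> mv_derivable q q' \<Longrightarrow> mv_derivable (p \<oplus> q) (p' \<oplus> q')"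
  using mv_derivable_trans mv_derivable_context[of p p' "\<lambda>p. p \<oplus> q"]
    mv_derivable_context[of q q' "\<lambda>q. p' \<oplus> q"] step.Oplus_left step.Oplus_right
  by metis

lemma mv_derivable_Odot:
  "mv_derivable p p' \<Longrightarrow> mv_derivable q q' \<Longrightarrow> mv_derivable (p \<odot> q) (p' \<odot> q')"
  using mv_derivable_trans mv_derivable_context[of p p' "\<lambda>p. p \<odot> q"]
    mv_derivable_context[of q q' "\<lambda>q. p' \<odot> q"] step.Odot_left step.Odot_right
  by metis

lemma mv_derivable_Neg: "mv_derivable p p' \<Longrightarrow> mv_derivable (\<^bold>\<not> p) (\<^bold>\<not> p')"
  using mv_derivable_context[of p p' Neg] step.Neg by metis

lemma mv_derivable_axiom:
  assumes "(a, b) \<in> mv_axioms"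
  shows "mv_derivable (subst s a) (subst s b)"
  unfolding mv_derivable_def
  by (rule r_into_rtranclp, rule step.here[OF assms]) (auto simp: instantiates_def)

text \<open>The axioms contain no variables but \<open>Var 0\<close>, \<open>Var 1\<close> and
  \<open>Var 2\<close>, so three formulae describe every instance.\<close>

lemmas mv_axiom = mv_derivable_axiom[where s = "\<lambda>i. if i = 0 then x else if i = 1 then y else z" for x y z,
    unfolded mv_axioms_def Let_def]

\<comment> \<open>The Lindenbaum algebra\<close>
quotient_type lindenbaum = fm / mv_derivable
  by (rule equivpI) (auto intro: reflpI sympI transpI mv_derivable_refl mv_derivable_sym mv_derivable_trans)

instantiation lindenbaum :: mv_algebra
begin

lift_definition zero_lindenbaum :: lindenbaum is Zero .
lift_definition one_lindenbaum :: lindenbaum is One .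
lift_definition plus_lindenbaum :: "lindenbaum \<Rightarrow> lindenbaum \<Rightarrow> lindenbaum" is Oplus
  by (rule mv_derivable_Oplus)
lift_definition times_lindenbaum :: "lindenbaum \<Rightarrow> lindenbaum \<Rightarrow> lindenbaum" is Odot
  by (rule mv_derivable_Odot)
lift_definition uminus_lindenbaum :: "lindenbaum \<Rightarrow> lindenbaum" is Neg
  by (rule mv_derivable_Neg)
definition less_eq_lindenbaum :: "lindenbaum \<Rightarrow> lindenbaum \<Rightarrow> bool" where
  "less_eq_lindenbaum x y \<longleftrightarrow> - x + y = 1"
definition less_lindenbaum :: "lindenbaum \<Rightarrow> lindenbaum \<Rightarrow> bool" where
  "less_lindenbaum x y \<longleftrightarrow> x \<le> y \<and> \<not> y \<le> x"

instance
proof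
  fix x y z :: lindenbaum
  have add_commute: "x + y = y + x" for x y :: lindenbaum
    by transfer (use mv_axiom[of "Var 0 \<oplus> Var 1" "Var 1 \<oplus> Var 0"] in simp)
  have mult_commute: "x * y = y * x" for x y :: lindenbaum
    by transfer (use mv_axiom[of "Var 0 \<odot> Var 1" "Var 1 \<odot> Var 0"] in simp)
  have neg_neg: "- (- x) = x" for x :: lindenbaum
    by transfer (use mv_derivable_sym[OF mv_axiom[of "Var 0" "\<^bold>\<not> (\<^bold>\<not> Var 0)"]] in simp)
  have neg_mult: "- (x * y) = - x + - y"
    by transfer (use mv_axiom[of "\<^bold>\<not> (Var 0 \<odot> Var 1)" "\<^bold>\<not> Var 0 \<oplus> \<^bold>\<not> Var 1"] in simp)
  show "x + y + z = x + (y + z)"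
    by transfer (use mv_derivable_sym[OF mv_axiom[of "Var 0 \<oplus> (Var 1 \<oplus> Var 2)" "Var 0 \<oplus> Var 1 \<oplus> Var 2"]] in simp)
  show "x * y * z = x * (y * z)"
    by transfer (use mv_derivable_sym[OF mv_axiom[of "Var 0 \<odot> (Var 1 \<odot> Var 2)" "Var 0 \<odot> Var 1 \<odot> Var 2"]] in simp)
  show "x + y = y + x" "x * y = y * x" "- (- x) = x"
    by (fact add_commute mult_commute neg_neg)+
  show "0 + x = x"
    unfolding add_commute[of 0] by transfer (use mv_axiom[of "Var 0 \<oplus> Zero" "Var 0"] in simp)
  show "1 * x = x"
    unfolding mult_commute[of 1] by transfer (use mv_axiom[of "Var 0 \<odot> One" "Var 0"] in simp)
  show "x + 1 = 1"
    by transfer (use mv_axiom[of "Var 0 \<oplus> One" "One"] in simp)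
  show "x * y = - (- x + - y)"
    by (metis neg_mult neg_neg)
  show "1 = - (0 :: lindenbaum)"
    by transfer (use mv_derivable_sym[OF mv_axiom[of "\<^bold>\<not> Zero" "One"]] in simp)
  show "x * - y + y = y * - x + x"
    by transfer (use mv_axiom[of "Var 0 \<odot> \<^bold>\<not> Var 1 \<oplus> Var 1" "Var 1 \<odot> \<^bold>\<not> Var 0 \<oplus> Var 0"] in simp)
  show "x \<le> y \<longleftrightarrow> - x + y = 1" "x < y \<longleftrightarrow> x \<le> y \<and> \<not> y \<le> x"
    by (fact less_eq_lindenbaum_def less_lindenbaum_def)+
qed

end

text \<open>A two-valued model of the axioms. It separates \<open>Zero\<close> from
  \<open>One\<close>, which guarantees that the Lindenbaum algebra has a prime filter at
  all.\<close>

primrec boolean_eval :: "fm \<Rightarrow> bool" where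
  "boolean_eval (Var i) \<longleftrightarrow> False"
| "boolean_eval Zero \<longleftrightarrow> False"
| "boolean_eval One \<longleftrightarrow> True"
| "boolean_eval (p \<oplus> q) \<longleftrightarrow> boolean_eval p \<or> boolean_eval q"
| "boolean_eval (p \<odot> q) \<longleftrightarrow> boolean_eval p \<and> boolean_eval q"
| "boolean_eval (\<^bold>\<not> p) \<longleftrightarrow> \<not> boolean_eval p"

lemma boolean_eval_derivable: "mv_derivable p q \<Longrightarrow> boolean_eval p = boolean_eval q"
  unfolding mv_derivable_def
proof (induction rule: rtranclp_induct)
  case (step q r)
  from step(2) have "boolean_eval q = boolean_eval r"
    by (induction rule: step.induct) (auto simp: mv_axioms_def Let_def instantiates_def)
  then show ?case
    using step by simp
qed simp

lemma lindenbaum_nontrivial: "(0 :: lindenbaum) \<noteq> 1"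
  by transfer (use boolean_eval_derivable in fastforce)

definition refutes_valid :: "lindenbaum set \<Rightarrow> bool" where
  "refutes_valid F \<longleftrightarrow> (\<exists>p q. valid_equation p q \<and> - abs_lindenbaum p + abs_lindenbaum q \<notin> F)"

text \<open>The quotient of the Lindenbaum algebra by a prime filter is to be a type, which cannot depend
  on the filter; hence one filter is chosen globally such that it refutes a valid equation if any
  prime filter does.\<close>

definition chosen_filter :: "lindenbaum set" where
  "chosen_filter = (SOME F. prime_filter F \<and> ((\<exists>G. prime_filter G \<and> refutes_valid G) \<longrightarrow> refutes_valid F))"

lemma chosen_filter:
  shows "prime_filter chosen_filter"
    and "prime_filter G \<Longrightarrow> refutes_valid G \<Longrightarrow> refutes_valid chosen_filter"
proof -
  \<comment> \<open>If no prime filter refutes a valid equation, the choice must still yield a prime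
    filter.\<close>
  obtain F0 :: "lindenbaum set" where "prime_filter F0"
    using prime_filter_exists[OF lindenbaum_nontrivial] by blast
  then have "\<exists>F. prime_filter F \<and> ((\<exists>G. prime_filter G \<and> refutes_valid G) \<longrightarrow> refutes_valid F)"
    by blast
  from someI_ex[OF this] show "prime_filter chosen_filter"
    "prime_filter G \<Longrightarrow> refutes_valid G \<Longrightarrow> refutes_valid chosen_filter"
    unfolding chosen_filter_def by blast+
qed

lemma chosen_filter_mv: "mv_filter chosen_filter"
  and zero_notin_chosen: "0 \<notin> chosen_filter"
  and chosen_prelinear: "- x + y \<in> chosen_filter \<or> - y + x \<in> chosen_filter"
  using chosen_filter(1) unfolding prime_filter_def by blast+

lemma chosen_refl: "- x + x \<in> chosen_filter" and one_in_chosen: "1 \<in> chosen_filter"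
  using mv_filterD(1)[OF chosen_filter_mv] by (simp_all add: neg_add_self)

section \<open>The chain obtained from the chosen filter\<close>

definition filter_eq :: "lindenbaum \<Rightarrow> lindenbaum \<Rightarrow> bool" where
  "filter_eq x y \<longleftrightarrow> - x + y \<in> chosen_filter \<and> - y + x \<in> chosen_filter"

lemma filter_eq_refl: "filter_eq x x"
  by (simp add: filter_eq_def chosen_refl)

lemma filter_eq_one_iff: "filter_eq x 1 \<longleftrightarrow> x \<in> chosen_filter"
  by (simp add: filter_eq_def add_one neg_one one_in_chosen)

lemma filter_eq_add: "filter_eq x x' \<Longrightarrow> filter_eq y y' \<Longrightarrow> filter_eq (x + y) (x' + y')"
  by (simp add: filter_eq_def filter_add[OF chosen_filter_mv])

lemma filter_eq_neg: "filter_eq x x' \<Longrightarrow> filter_eq (- x) (- x')"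
  by (simp add: filter_eq_def neg_neg add.commute)

quotient_type lindenbaum_chain = lindenbaum / filter_eq
proof (rule equivpI)
  show "reflp filter_eq" "symp filter_eq"
    by (auto intro!: reflpI sympI simp: filter_eq_refl) (auto simp: filter_eq_def)
  show "transp filter_eq"
    unfolding filter_eq_def transp_def using filter_trans[OF chosen_filter_mv] by blast
qed

instantiation lindenbaum_chain :: mv_chain
begin

lift_definition zero_lindenbaum_chain :: lindenbaum_chain is 0 .
lift_definition one_lindenbaum_chain :: lindenbaum_chain is 1 .
lift_definition plus_lindenbaum_chain :: "lindenbaum_chain \<Rightarrow> lindenbaum_chain \<Rightarrow> lindenbaum_chain" is "(+)"
  by (rule filter_eq_add)
lift_definition uminus_lindenbaum_chain :: "lindenbaum_chain \<Rightarrow> lindenbaum_chain" is uminus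
  by (rule filter_eq_neg)
lift_definition times_lindenbaum_chain :: "lindenbaum_chain \<Rightarrow> lindenbaum_chain \<Rightarrow> lindenbaum_chain" is "(*)"
  unfolding times_def by (intro filter_eq_neg filter_eq_add)
definition less_eq_lindenbaum_chain :: "lindenbaum_chain \<Rightarrow> lindenbaum_chain \<Rightarrow> bool" where
  "less_eq_lindenbaum_chain x y \<longleftrightarrow> - x + y = 1"
definition less_lindenbaum_chain :: "lindenbaum_chain \<Rightarrow> lindenbaum_chain \<Rightarrow> bool" where
  "less_lindenbaum_chain x y \<longleftrightarrow> x \<le> y \<and> \<not> y \<le> x"

instance
proof
  fix x y z :: lindenbaum_chain
  show "x + y + z = x + (y + z)" "x * y * z = x * (y * z)" "x + y = y + x" "x * y = y * x"
    "0 + x = x" "1 * x = x"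
    by (transfer; simp add: ac_simps filter_eq_refl)+
  show "x + 1 = 1" "- (- x) = x" "1 = - (0 :: lindenbaum_chain)"
    by (transfer; simp add: add_one neg_neg neg_zero filter_eq_refl)+
  show "x * y = - (- x + - y)"
    by transfer (simp only: times_def filter_eq_refl)
  show "x * - y + y = y * - x + x"
    by transfer (simp only: join_commute filter_eq_refl)
  show "x \<le> y \<longleftrightarrow> - x + y = 1" "x < y \<longleftrightarrow> x \<le> y \<and> \<not> y \<le> x"
    by (fact less_eq_lindenbaum_chain_def less_lindenbaum_chain_def)+
  show "x \<le> y \<or> y \<le> x"
    unfolding less_eq_lindenbaum_chain_def
    by transfer (simp add: filter_eq_one_iff chosen_prelinear)
  show "(0 :: lindenbaum_chain) \<noteq> 1"
    by transfer (simp add: filter_eq_one_iff zero_notin_chosen)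
qed

end

text \<open>An equation that holds in the chain under this canonical valuation holds between the
  classes of its two sides; this turns \<open>chain_valid\<close> into membership in the
  filter.\<close>

lemma mv_eval_lindenbaum_chain:
  "mv_eval (\<lambda>i. abs_lindenbaum_chain (abs_lindenbaum (Var i))) p = abs_lindenbaum_chain (abs_lindenbaum p)"
  by (induction p) (simp_all add: zero_lindenbaum_chain_def one_lindenbaum_chain_def
      plus_lindenbaum_chain.abs_eq times_lindenbaum_chain.abs_eq uminus_lindenbaum_chain.abs_eq
      zero_lindenbaum_def one_lindenbaum_def
      plus_lindenbaum.abs_eq times_lindenbaum.abs_eq uminus_lindenbaum.abs_eq)

lemma no_refutation: "\<not> refutes_valid chosen_filter"
proof
  assume "refutes_valid chosen_filter"
  then obtain p q where "valid_equation p q" "- abs_lindenbaum p + abs_lindenbaum q \<notin> chosen_filter"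
    unfolding refutes_valid_def by blast
  moreover have "filter_eq (abs_lindenbaum p) (abs_lindenbaum q)"
    using chain_valid[OF \<open>valid_equation p q\<close>,
        of "\<lambda>i. abs_lindenbaum_chain (abs_lindenbaum (Var i))"]
    by (simp add: mv_eval_lindenbaum_chain flip: lindenbaum_chain.abs_eq_iff)
  ultimately show False
    by (simp add: filter_eq_def)
qed

text \<open>A failure yields a prime filter omitting the implication; then the chosen filter refutes
  a valid equation as well, though not necessarily this one.\<close>

lemma valid_le:
  assumes "valid_equation p q"
  shows "abs_lindenbaum p \<le> abs_lindenbaum q"
proof (rule ccontr)
  assume "\<not> ?thesis"
  then obtain F where "prime_filter F" "- abs_lindenbaum p + abs_lindenbaum q \<notin> F"
    using prime_filter_exists unfolding le_iff by blast
  then show False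
    using no_refutation chosen_filter(2) assms unfolding refutes_valid_def by blast
qed

theorem chang_completeness:
  assumes "valid_equation p q"
  shows "mv_derivable p q"
proof -
  have "valid_equation q p"
    using assms by (simp add: valid_equation_def)
  then have "abs_lindenbaum p = abs_lindenbaum q"
    using assms valid_le by (blast intro: antisym)
  then show ?thesis
    by (simp add: lindenbaum.abs_eq_iff)
qed


section \<open>Truth functions of extracted formulae\<close>

lemma clip_range: "0 \<le> clip t" "clip t \<le> 1"
  by (simp_all add: clip_def)

lemma clip_eq_self: "0 \<le> t \<Longrightarrow> t \<le> 1 \<Longrightarrow> clip t = t"
  by (simp add: clip_def)

lemma clip_one_minus: "clip (1 - t) = 1 - clip t"
  by (auto simp: clip_def max_def min_def)

text \<open>The recursion step of \<open>extr\<close>. For \<open>f \<ge> t\<close> the second clip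
  is \<open>1\<close> and the sum gives \<open>f\<close> cut off at \<open>1\<close>; for
  \<open>f \<le> t\<close> the first clip is \<open>0\<close> and the rest gives \<open>f\<close>
  cut off at \<open>0\<close>.\<close>

lemma clip_split:
  assumes "0 \<le> t" "t \<le> 1"
  shows "clip f = max 0 (min 1 (clip (f - t) + t) + clip (f - t + 1) - 1)"
  using assms unfolding clip_def max_def min_def by auto

lemma nth_cube: "x \<in> cube n \<Longrightarrow> i < n \<Longrightarrow> 0 \<le> x ! i \<and> x ! i \<le> 1"
  using nth_mem[of i x] by (auto simp: cube_def subset_iff)

text \<open>Boundedness is what makes the infimum and supremum in \<open>cube_min\<close> and
  \<open>cube_max\<close> actual bounds.\<close>

lemma int_affine_bounded:
  assumes "x \<in> cube (length ms)"
  shows "\<bar>int_affine ms b x\<bar> \<le> (\<Sum>i<length ms. real_of_int \<bar>ms ! i\<bar>) + real_of_int \<bar>b\<bar>"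
proof -
  have "\<bar>\<Sum>i<length ms. real_of_int (ms ! i) * x ! i\<bar> \<le> (\<Sum>i<length ms. \<bar>real_of_int (ms ! i) * x ! i\<bar>)"
    by (rule sum_abs)
  also have "\<dots> \<le> (\<Sum>i<length ms. real_of_int \<bar>ms ! i\<bar>)"
    using nth_cube[OF assms] by (intro sum_mono) (simp add: abs_mult mult_left_le)
  finally show ?thesis
    by (simp add: int_affine_def affine_def)
qed

lemma cube_min_le: "x \<in> cube (length ms) \<Longrightarrow> cube_min ms b \<le> int_affine ms b x"
  unfolding cube_min_def
  by (rule cINF_lower)
    (auto intro!: bdd_belowI2[where m = "- ((\<Sum>i<length ms. real_of_int \<bar>ms ! i\<bar>) + real_of_int \<bar>b\<bar>)"]
      dest: int_affine_bounded[of _ _ b])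

lemma le_cube_max: "x \<in> cube (length ms) \<Longrightarrow> int_affine ms b x \<le> cube_max ms b"
  unfolding cube_max_def
  by (rule cSUP_upper)
    (auto intro!: bdd_aboveI2[where M = "(\<Sum>i<length ms. real_of_int \<bar>ms ! i\<bar>) + real_of_int \<bar>b\<bar>"]
      dest: int_affine_bounded[of _ _ b])

lemma int_affine_decrease:
  assumes "k < length ms"
  shows "int_affine (ms[k := ms ! k - 1]) b x = int_affine ms b x - x ! k"
proof -
  have "(\<Sum>i<length ms. real_of_int (ms[k := ms ! k - 1] ! i) * x ! i) =
    (\<Sum>i<length ms. real_of_int (ms ! i) * x ! i - (if i = k then x ! i else 0))"
    by (intro sum.cong) (auto simp: algebra_simps)
  also have "\<dots> = (\<Sum>i<length ms. real_of_int (ms ! i) * x ! i) - x ! k"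
    using assms by (simp add: sum_subtractf)
  finally show ?thesis
    by (simp add: int_affine_def affine_def)
qed

lemma int_affine_add_bias: "int_affine ms (b + c) x = int_affine ms b x + real_of_int c"
  by (simp add: int_affine_def affine_def)

lemma int_affine_uminus: "int_affine (map uminus ms) (1 - b) x = 1 - int_affine ms b x"
  by (simp add: int_affine_def affine_def sum_negf)

text \<open>Dropping \<open>Zero\<close> removes a truncation at \<open>1\<close>, hence the
  hypothesis on \<open>q\<close>; dropping \<open>One\<close> below removes a truncation at
  \<open>0\<close>.\<close>

lemma eval_oplus_simp: "eval (1 :: real) v q \<le> 1 \<Longrightarrow> eval 1 v (oplus_simp p q) = eval 1 v (p \<oplus> q)"
  by (simp add: oplus_simp_def)

lemma eval_odot_simp: "0 \<le> eval (1 :: real) v p \<Longrightarrow> eval 1 v (odot_simp p q) = eval 1 v (p \<odot> q)"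
  by (simp add: odot_simp_def)

lemma eval_extr:
  assumes "x \<in> cube (length ms)" "\<And>i. i < length ms \<Longrightarrow> v i = x ! i"
  shows "eval 1 v (extr ms b) = clip (int_affine ms b x)"
  using assms
proof (induction ms b rule: extr.induct)
  case (1 ms b)
  define k where "k = first_nonzero ms"
  consider "1 \<le> cube_min ms b" | "\<not> 1 \<le> cube_min ms b" "cube_max ms b \<le> 0"
    | "\<not> 1 \<le> cube_min ms b" "\<not> cube_max ms b \<le> 0" "1 \<le> ms ! k"
    | "\<not> 1 \<le> cube_min ms b" "\<not> cube_max ms b \<le> 0" "\<not> 1 \<le> ms ! k"
    by blast
  then show ?case
  proof cases
    case 1
    then have "1 \<le> int_affine ms b x"
      using cube_min_le[OF "1.prems"(1), of b] by simp
    then show ?thesis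
      using 1 by (simp add: extr.simps[of ms b] clip_def)
  next
    case 2
    then have "int_affine ms b x \<le> 0"
      using le_cube_max[OF "1.prems"(1), of b] by simp
    then show ?thesis
      using 2 by (simp add: extr.simps[of ms b] clip_def)
  next
    case 3
    let ?ms = "ms[k := ms ! k - 1]"
    have k: "k < length ms"
      using first_nonzero(1)[OF 3(1,2)] by (simp add: k_def)
    have vk: "v k = x ! k" "0 \<le> v k" "v k \<le> 1"
      using "1.prems"(2)[OF k] nth_cube[OF "1.prems"(1) k] by simp_all
    have "eval 1 v (extr ?ms b) = clip (int_affine ms b x - v k)"
      using "1.IH"(1)[OF 3(1,2) refl refl] 3(3) "1.prems"
      by (simp add: k_def[symmetric] int_affine_decrease[OF k] vk(1))
    moreover have "eval 1 v (extr ?ms (b + 1)) = clip (int_affine ms b x - v k + 1)"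
      using "1.IH"(2)[OF 3(1,2) refl refl] 3(3) "1.prems"
      by (simp add: k_def[symmetric] int_affine_decrease[OF k] int_affine_add_bias[of _ b 1] vk(1))
    moreover have "extr ms b = odot_simp (oplus_simp (extr ?ms b) (Var k)) (extr ?ms (b + 1))"
      using 3 by (simp add: extr.simps[of ms b] k_def[symmetric] Let_def)
    ultimately show ?thesis
      using clip_split[OF vk(2,3), of "int_affine ms b x"] vk(2,3) clip_range(1)
      by (simp add: eval_oplus_simp eval_odot_simp)
  next
    case 4
    have "extr ms b = \<^bold>\<not> extr (map uminus ms) (1 - b)"
      using 4 by (simp add: extr.simps[of ms b] k_def[symmetric] Let_def)
    moreover have "eval 1 v (extr (map uminus ms) (1 - b)) = clip (1 - int_affine ms b x)"
      using "1.IH"(3)[OF 4(1,2) refl refl] 4(3) "1.prems"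
      by (simp add: k_def[symmetric] int_affine_uminus)
    ultimately show ?thesis
      by (simp add: clip_one_minus)
  qed
qed

section \<open>Correctness of the extraction\<close>

definition fits :: "nat \<Rightarrow> node \<Rightarrow> bool" where
  "fits d v \<longleftrightarrow> length (weights v) = d \<and> set (weights v) \<subseteq> \<int> \<and> bias v \<in> \<int>"

text \<open>The indexed conditions on a network recast along the recursion of
  \<open>convert_layers\<close>, with hidden activation \<open>a\<close> and output activation
  \<open>b\<close>, so that one predicate serves before and after the conversion.\<close>

fun layered :: "(real \<Rightarrow> real) \<Rightarrow> (real \<Rightarrow> real) \<Rightarrow> nat \<Rightarrow> node list list \<Rightarrow> bool" where
  "layered a b d [] \<longleftrightarrow> False"
| "layered a b d [l] \<longleftrightarrow> (\<exists>v. l = [v] \<and> fits d v \<and> activation v = b)"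
| "layered a b d (l # l' # ls) \<longleftrightarrow>
     (\<forall>v\<in>set l. fits d v \<and> activation v = a) \<and> layered a b (length l) (l' # ls)"

definition run :: "node list list \<Rightarrow> real list \<Rightarrow> real list" where
  "run ls x = fold (\<lambda>l y. map (\<lambda>v. local_map v y) l) ls x"

lemma run_simps: "run [] x = x" "run (l # ls) x = run ls (map (\<lambda>v. local_map v x) l)"
  by (simp_all add: run_def)

lemma run_nonempty: "layered a b d ls \<Longrightarrow> run ls x \<noteq> []"
  by (induction a b d ls arbitrary: x rule: layered.induct) (auto simp: run_simps)

lemma level_values_run: "j \<le> depth N \<Longrightarrow> level_values N j x = run (take j (layers N)) x"
  by (induction j) (simp_all add: run_def depth_def take_Suc_conv_app_nth)

lemma network_map_run: "network_map N x = run (layers N) x ! 0"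
  by (simp add: network_map_def global_map_def level_values_run) (simp add: depth_def)

lemma layeredI:
  assumes "ls \<noteq> []" "length (last ls) = 1" "\<And>v. v \<in> set (last ls) \<Longrightarrow> activation v = b"
    and "\<And>j v. Suc j < length ls \<Longrightarrow> v \<in> set (ls ! j) \<Longrightarrow> activation v = a"
    and "\<And>j v. j < length ls \<Longrightarrow> v \<in> set (ls ! j) \<Longrightarrow> fits (if j = 0 then d else length (ls ! (j - 1))) v"
  shows "layered a b d ls"
  using assms
proof (induction a b d ls rule: layered.induct)
  case (2 a b d l)
  then show ?case
    by (auto simp: length_Suc_conv)
next
  case (3 a b d l l' ls)
  have "layered a b (length l) (l' # ls)"
  proof (rule "3.IH")
    show "fits (if j = 0 then length l else length ((l' # ls) ! (j - 1))) v"
      if "j < length (l' # ls)" "v \<in> set ((l' # ls) ! j)" for j v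
      using "3.prems"(5)[of "Suc j" v] that by (cases j) auto
    show "activation v = a" if "Suc j < length (l' # ls)" "v \<in> set ((l' # ls) ! j)" for j v
      using "3.prems"(4)[of "Suc j" v] that by auto
  qed (use "3.prems"(1-3) in auto)
  moreover have "fits d v \<and> activation v = a" if "v \<in> set l" for v
    using "3.prems"(4,5)[of 0 v] that by simp
  ultimately show ?case
    by simp
qed simp

lemma layered_network:
  assumes "relu_network N" "integer_network N"
  shows "layered relu id (inputs N) (layers N)"
proof (rule layeredI)
  have valid: "valid_network N"
    using assms(1) by (simp add: relu_network_def)
  show "layers N \<noteq> []"
    using valid by (auto simp: valid_network_def depth_def)
  then have last: "last (layers N) = layers N ! (depth N - 1)" and "0 < depth N"
    by (simp_all add: last_conv_nth depth_def)
  show "length (last (layers N)) = 1"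
    using valid last \<open>0 < depth N\<close> by (simp add: valid_network_def width_def)
  then show "activation v = id" if "v \<in> set (last (layers N))" for v
    using that assms(1) last by (auto simp: relu_network_def node_at_def length_Suc_conv)
  show "activation v = relu" if j: "Suc j < length (layers N)" "v \<in> set (layers N ! j)" for j v
  proof -
    obtain i where "i < length (layers N ! j)" "v = layers N ! j ! i"
      using j(2) by (metis in_set_conv_nth)
    moreover have "Suc j \<in> {1..<depth N}"
      using j(1) by (simp add: depth_def)
    ultimately show ?thesis
      using assms(1) unfolding relu_network_def node_at_def width_def by fastforce
  qed
  show "fits (if j = 0 then inputs N else length (layers N ! (j - 1))) v"
    if j: "j < length (layers N)" "v \<in> set (layers N ! j)" for j v
  proof -
    obtain i where i: "i < length (layers N ! j)" "v = layers N ! j ! i"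
      using j(2) by (metis in_set_conv_nth)
    have "Suc j \<in> {1..depth N}"
      using j(1) by (simp add: depth_def)
    moreover have "i < width N (Suc j)" "v = node_at N (Suc j) i"
      using i by (simp_all add: width_def node_at_def)
    ultimately have "length (weights v) = width N j" "set (weights v) \<subseteq> \<int>" "bias v \<in> \<int>"
      using valid assms(2) unfolding valid_network_def integer_network_def
      by (metis diff_Suc_1)+
    then show ?thesis
      by (simp add: fits_def width_def)
  qed
qed

section \<open>Substitution graphs of clipped networks\<close>

lemma eval_node_formula:
  assumes "fits d w" "activation w = clip" "x \<in> cube d" "\<And>i. i < d \<Longrightarrow> v i = x ! i"
  shows "eval 1 v (node_formula w) = local_map w x"
proof -
  have "map (\<lambda>r. real_of_int \<lfloor>r\<rfloor>) (weights w) = weights w" "real_of_int \<lfloor>bias w\<rfloor> = bias w"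
    using assms(1) by (auto simp: fits_def subset_iff intro!: map_idI elim!: Ints_cases)
  then have "int_affine (map floor (weights w)) \<lfloor>bias w\<rfloor> x = affine (weights w) (bias w) x"
    by (simp only: int_affine_def map_map o_def)
  then show ?thesis
    using assms eval_extr[of x "map floor (weights w)" v "\<lfloor>bias w\<rfloor>"]
    by (simp add: node_formula_def local_map_def fits_def)
qed

lemma eval_subst: "eval u v (subst s p) = eval u (\<lambda>i. eval u v (s i)) p"
  by (induction p) simp_all

text \<open>The outermost substitution belongs to the level nearest to the inputs. Under evaluation
  it becomes a change of valuation to the values of that level, so the induction runs from the
  inputs.\<close>

lemma eval_represented:
  assumes "layered clip clip d ls" "x \<in> cube d" "\<And>i. i < d \<Longrightarrow> v i = x ! i"
  shows "eval 1 v (foldr replace_vars (butlast (map (map node_formula) ls))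
    (hd (last (map (map node_formula) ls)))) = run ls x ! 0"
  using assms
proof (induction ls arbitrary: d x v rule: induct_list012)
  case (2 l)
  then obtain w where "l = [w]" "fits d w" "activation w = clip"
    by auto
  then show ?case
    using 2 eval_node_formula by (simp add: run_simps)
next
  case (3 l l' ls)
  define x' where "x' = map (\<lambda>v. local_map v x) l"
  \<comment> \<open>Variables beyond the level keep their value because \<open>replace_vars\<close>
    leaves them alone.\<close>
  define v' where "v' = (\<lambda>i. if i < length l then eval 1 v (node_formula (l ! i)) else v i)"
  have l: "fits d w" "activation w = clip" if "w \<in> set l" for w
    using 3(3) that by simp_all
  have "x' \<in> cube (length l)"
    using l(2) clip_range by (auto simp: x'_def cube_def local_map_def)
  moreover have "v' i = x' ! i" if "i < length l" for i
    using eval_node_formula[OF l] 3(4,5) that by (simp add: v'_def x'_def)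
  moreover have "layered clip clip (length l) (l' # ls)"
    using 3(3) by simp
  ultimately have "eval 1 v' (foldr replace_vars (butlast (map (map node_formula) (l' # ls)))
    (hd (last (map (map node_formula) (l' # ls))))) = run (l' # ls) x' ! 0"
    by (intro 3(2))
  moreover have "eval 1 v (replace_vars (map node_formula l) q) = eval 1 v' q" for q
    by (simp add: replace_vars_def eval_subst v'_def if_distrib[of "eval _ _"] cong: if_cong)
  ultimately show ?case
    by (simp only: list.map butlast.simps last.simps foldr.simps o_apply run_simps x'_def list.distinct if_False)
qed simp

text \<open>Summand \<open>k\<close> contributes the part of \<open>t\<close> between
  \<open>k\<close> and \<open>k + 1\<close>.\<close>

lemma sum_clip: "(\<Sum>k<m. clip (t - real k)) = min (relu t) (real m)"
proof (induction m)
  case (Suc m)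
  then show ?case
    by (auto simp: clip_def relu_def min_def max_def)
qed (simp add: relu_def)

lemma affine_sum_list:
  "length ws = length x \<Longrightarrow> affine ws b x = (\<Sum>(w, t)\<leftarrow>zip ws x. w * t) + b"
  by (simp add: affine_def sum_list_sum_nth atLeast0LessThan)

text \<open>All copies of a parent carry its weight, so only the sum of their values matters;
  \<open>zs\<close> groups the values by original parent.\<close>

lemma affine_widen:
  assumes "length ws = length zs"
  shows "affine (concat (map2 replicate (map length zs) ws)) b (concat zs) = affine ws b (map sum_list zs)"
proof -
  have *: "(\<Sum>(w, t)\<leftarrow>zip (replicate (length z) a) z. w * t) = a * sum_list z" for a and z :: "real list"
    by (induction z) (simp_all add: algebra_simps)
  have "(\<Sum>(w, t)\<leftarrow>zip (concat (map2 replicate (map length zs) ws)) (concat zs). w * t) =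
      (\<Sum>(w, t)\<leftarrow>zip ws (map sum_list zs). w * t)"
    and "length (concat (map2 replicate (map length zs) ws)) = length (concat zs)"
    using assms by (induction ws zs rule: list_induct2) (simp_all add: *)
  then show ?thesis
    using assms by (simp add: affine_sum_list)
qed

lemma affine_le_upper:
  assumes "x \<in> cube (length (weights v))"
  shows "affine (weights v) (bias v) x \<le> upper v"
proof -
  have "(\<Sum>i<length (weights v). weights v ! i * x ! i) \<le> (\<Sum>i<length (weights v). max (weights v ! i) 0)"
  proof (rule sum_mono)
    fix i assume "i \<in> {..<length (weights v)}"
    then have "0 \<le> x ! i" "x ! i \<le> 1"
      using nth_cube[OF assms] by simp_all
    then show "weights v ! i * x ! i \<le> max (weights v ! i) 0"
      by (cases "0 \<le> weights v ! i") (auto simp: mult_left_le mult_nonpos_nonneg max_def)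
  qed
  then show ?thesis
    by (simp add: affine_def upper_def sum_list_sum_nth atLeast0LessThan)
qed

text \<open>\<open>upper\<close> bounds the preactivation on the cube, so the truncation of
  \<open>sum_clip\<close> at \<open>copies v\<close> has no effect.\<close>

lemma sum_split_node:
  assumes "x \<in> cube (length (weights v))"
  shows "(\<Sum>w\<leftarrow>split_node v. local_map w x) = relu (affine (weights v) (bias v) x)"
proof -
  let ?t = "affine (weights v) (bias v) x"
  have "?t \<le> real (copies v)"
    using affine_le_upper[OF assms] order_trans[OF affine_le_upper[OF assms] le_of_int_ceiling]
    by (auto simp: copies_def)
  moreover have "0 \<le> real (copies v)"
    by simp
  ultimately have "relu ?t \<le> real (copies v)"
    by (simp add: relu_def)
  moreover have "(\<Sum>w\<leftarrow>split_node v. local_map w x) = (\<Sum>k<copies v. clip (?t - real k))"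
    by (simp add: split_node_def local_map_def affine_def o_def sum_list_sum_nth atLeast0LessThan algebra_simps)
  ultimately show ?thesis
    by (simp add: sum_clip)
qed

lemma length_split_node: "length (split_node v) = copies v"
  by (simp add: split_node_def)

lemma fits_widen: "fits (length cs) v \<Longrightarrow> fits (sum_list cs) (widen cs v)"
  by (auto simp: fits_def widen_def length_concat o_def split_def map_fst_zip subset_iff
      dest: set_zip_rightD)

lemma fits_split_node: "fits d v \<Longrightarrow> w \<in> set (split_node v) \<Longrightarrow> fits d w \<and> activation w = clip"
  by (auto simp: fits_def split_node_def)

lemma layered_convert:
  assumes "layered relu id (length cs) ls"
  shows "layered clip clip (sum_list cs) (convert_layers cs ls)"
  using assms
proof (induction cs ls rule: convert_layers.induct)
  case (2 cs l)
  then show ?case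
    using fits_widen by (fastforce simp: fits_def widen_def)
next
  case (3 cs l l' ls)
  define vs where "vs = map (widen cs) l"
  have "layered clip clip (sum_list (map copies vs)) (convert_layers (map copies vs) (l' # ls))"
    using "3.IH"[OF vs_def] "3.prems" by (simp add: vs_def)
  moreover have "length (concat (map split_node vs)) = sum_list (map copies vs)"
    by (simp add: length_concat o_def length_split_node)
  moreover have "fits (sum_list cs) w \<and> activation w = clip" if "w \<in> set (concat (map split_node vs))" for w
    using that fits_split_node fits_widen "3.prems" by (fastforce simp: vs_def)
  \<comment> \<open>Nonemptiness of the remaining levels selects the clause of
    \<open>layered\<close> for hidden levels.\<close>
  moreover obtain m ms where "convert_layers (map copies vs) (l' # ls) = m # ms"
    by (cases ls) (simp_all add: Let_def)
  ultimately show ?case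
    by (simp add: vs_def[symmetric])
qed simp

text \<open>Invariant: each entry of \<open>zs\<close> lists the values of the copies of one node,
  and their sum is the value of that node before conversion. The copies take values in the unit
  interval, as \<open>sum_split_node\<close> requires; the output node is clipped but not
  split.\<close>

lemma run_convert:
  assumes "layered relu id (length zs) ls" "set (concat zs) \<subseteq> {0..1}"
  shows "run (convert_layers (map length zs) ls) (concat zs) = map clip (run ls (map sum_list zs))"
  using assms
proof (induction "map length zs" ls arbitrary: zs rule: convert_layers.induct)
  case (2 l)
  then show ?case
    using affine_widen[of "weights (hd l)" zs]
    by (auto simp: run_simps local_map_def widen_def fits_def)
next
  case (3 l l' ls)
  define vs where "vs = map (widen (map length zs)) l"
  define zs' where "zs' = map (\<lambda>v. map (\<lambda>w. local_map w (concat zs)) (split_node v)) vs"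
  have cube: "concat zs \<in> cube (sum_list (map length zs))"
    using "3.prems"(2) by (simp add: cube_def length_concat)
  have len: "map length zs' = map copies vs"
    by (simp add: zs'_def length_split_node)
  have "map sum_list zs' = map (\<lambda>v. local_map v (map sum_list zs)) l"
  proof -
    have "sum_list (map (\<lambda>w. local_map w (concat zs)) (split_node (widen (map length zs) v))) =
      local_map v (map sum_list zs)" if "v \<in> set l" for v
    proof -
      have v: "fits (length zs) v" "activation v = relu"
        using "3.prems"(1) that by simp_all
      then have "concat zs \<in> cube (length (weights (widen (map length zs) v)))"
        using cube fits_widen[of "map length zs" v] by (simp add: fits_def)
      from sum_split_node[OF this] show ?thesis
        using v affine_widen[of "weights v" zs] by (simp add: widen_def local_map_def fits_def)
    qed
    then show ?thesis
      by (simp add: zs'_def vs_def)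
  qed
  moreover have "concat zs' = map (\<lambda>w. local_map w (concat zs)) (concat (map split_node vs))"
    by (simp add: zs'_def map_concat o_def)
  moreover have "run (convert_layers (map length zs') (l' # ls)) (concat zs') =
      map clip (run (l' # ls) (map sum_list zs'))"
  proof (rule "3.hyps")
    show "vs = map (widen (map length zs)) l" "map copies vs = map length zs'"
      by (simp_all add: vs_def len)
    show "layered relu id (length zs') (l' # ls)"
      using "3.prems"(1) by (simp add: zs'_def vs_def)
    show "set (concat zs') \<subseteq> {0..1}"
      using clip_range by (auto simp: zs'_def split_node_def local_map_def)
  qed
  ultimately show ?case
    by (simp add: Let_def vs_def[symmetric] run_simps len)
qed simp

lemma eval_represented_ext:
  assumes "N \<in> network_class n" "range v \<subseteq> {0..1}"
  shows "eval 1 v (represented (ext N)) = network_map N (map v [0..<n])"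
proof -
  let ?x = "map v [0..<n]" and ?ls = "layers (convert N)"
  \<comment> \<open>Every input node is its own single copy.\<close>
  define zs where "zs = map (\<lambda>t. [t]) ?x"
  have N: "relu_network N" "integer_network N" "inputs N = n" "network_map N ` cube n \<subseteq> {0..1}"
    using assms(1) by (simp_all add: network_class_def)
  have zs: "concat zs = ?x" "map sum_list zs = ?x" "map length zs = replicate n 1" "length zs = n"
    by (simp_all add: zs_def o_def map_replicate_const)
  have x: "?x \<in> cube n"
    using assms(2) by (auto simp: cube_def)
  have layered: "layered relu id n (layers N)"
    using layered_network[OF N(1,2)] N(3) by simp
  then have lc: "layered clip clip n ?ls"
    using layered_convert[of "replicate n 1" "layers N"] N(3)
    by (simp add: convert_def sum_list_replicate)
  then have "?ls \<noteq> []"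
    by auto
  then have "represented (ext N) = replace_vars (map Var [0..<n])
      (foldr replace_vars (butlast (map (map node_formula) ?ls)) (hd (last (map (map node_formula) ?ls))))"
    using N(3) by (simp add: represented_def ext_def foldr_conv_fold)
  \<comment> \<open>The substitution at the input level replaces each variable by itself and does
    not affect the value.\<close>
  also have "eval 1 v \<dots> = run ?ls ?x ! 0"
    using eval_represented[OF lc x]
    by (simp add: replace_vars_def eval_subst if_distrib[of "eval _ _"] cong: if_cong)
  also have "run ?ls ?x = map clip (run (layers N) ?x)"
    using run_convert[of zs "layers N"] layered x N(3) by (simp add: zs convert_def cube_def)
  also have "\<dots> ! 0 = clip (network_map N ?x)"
  proof -
    have "run (layers N) ?x \<noteq> []"
      using layered by (rule run_nonempty)
    then show ?thesis
      by (simp add: network_map_run)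
  qed
  also have "\<dots> = network_map N ?x"
    using N(4) x by (intro clip_eq_self) auto
  finally show ?thesis .
qed

theorem theorem3:
  fixes n :: nat and N1 N2 :: network
  assumes "N1 \<in> network_class n" and "N2 \<in> network_class n"
    and "\<forall>x\<in>cube n. network_map N1 x = network_map N2 x"
  shows "network_derivable N1 N2"
proof -
  \<comment> \<open>Valuations range over all variables, while the networks see only the first
    \<open>n\<close> coordinates.\<close>
  have "map v [0..<n] \<in> cube n" if "range v \<subseteq> {0..1}" for v :: "nat \<Rightarrow> real"
    using that by (auto simp: cube_def)
  then have "valid_equation (represented (ext N1)) (represented (ext N2))"
    using assms eval_represented_ext unfolding valid_equation_def by simp
  then show ?thesis
    unfolding network_derivable_def by (rule chang_completeness)
qed

end
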